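(* Let $n$ and $m$ be positive integers. If $m$ orthoconvex curves, each with at most one inner corner, cover the $n\times n$ grid $[n]\times[n]\subset\mathbb{R}^2$, then $m\geq 2n/5$.
   Context: $[n]=\{1,2,\ldots,n\}$. A curve covers a point if the point lies on the curve; a collection of curves covers a point set if every point of the set lies on at least one curve of the collection. A set $K\subseteq\mathbb{R}^2$ is orthogonally convex if, for every line $\ell$ parallel to $(1,0)$ or $(0,1)$, the intersection $K\cap\ell$ is empty, a point, or a single segment. The orthogonal convex hull of a point set in $\mathbb{R}^2$ is the intersection of all connected orthogonally convex supersets of it. An orthoconvex curve is a rectilinear curve (consisting of finitely many horizontal and vertical segments) that is the boundary of the orthogonal convex hull of a set of points and is a simple closed curve. All interior angles of such a curve at its corners are 90 or 270 degrees; an inner corner is a corner at which the interior angle is 270 degrees. Different curves need not have the same size. *)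

theory Defs
  imports "HOL-Analysis.Analysis"
begin

definition orthogonally_convex :: "(real \<times> real) set \<Rightarrow> bool" where
  "orthogonally_convex K \<longleftrightarrow>
     (\<forall>l c. l = {p. snd p = c} \<or> l = {p. fst p = c} \<longrightarrow>
        K \<inter> l = {} \<or> (\<exists>p. K \<inter> l = {p}) \<or> (\<exists>a b. K \<inter> l = closed_segment a b))"

definition orthogonal_convex_hull :: "(real \<times> real) set \<Rightarrow> (real \<times> real) set" where
  "orthogonal_convex_hull S = \<Inter> {K. S \<subseteq> K \<and> connected K \<and> orthogonally_convex K}"

definition rectilinear :: "(real \<times> real) set \<Rightarrow> bool" where
  "rectilinear C \<longleftrightarrow>
     (\<exists>F. finite F \<and> C = \<Union> F \<and>
        (\<forall>s\<in>F. \<exists>a b. s = closed_segment a b \<and> (fst a = fst b \<or> snd a = snd b)))"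

definition simple_closed_curve :: "(real \<times> real) set \<Rightarrow> bool" where
  "simple_closed_curve C \<longleftrightarrow>
     (\<exists>g. simple_path g \<and> pathfinish g = pathstart g \<and> path_image g = C)"

definition orthoconvex_curve :: "(real \<times> real) set \<Rightarrow> bool" where
  "orthoconvex_curve C \<longleftrightarrow>
     rectilinear C \<and> simple_closed_curve C \<and> (\<exists>S. C = frontier (orthogonal_convex_hull S))"

definition corner :: "(real \<times> real) set \<Rightarrow> real \<times> real \<Rightarrow> bool" where
  "corner C p \<longleftrightarrow>
     (\<exists>q. q \<noteq> p \<and> snd q = snd p \<and> closed_segment p q \<subseteq> C) \<and>
     (\<exists>q. q \<noteq> p \<and> fst q = fst p \<and> closed_segment p q \<subseteq> C)"

text \<open>The interior angle at \<open>p\<close> is \<open>\<alpha>\<close> (in radians) if, in a small punctured disc around \<open>p\<close>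
  written in polar coordinates \<open>(\<rho>, \<theta>)\<close>, the region enclosed by the curve is exactly an open
  sector of opening \<open>\<alpha>\<close>; here \<open>\<phi>\<close> is the direction of one of the two bounding rays.\<close>

definition has_interior_angle :: "(real \<times> real) set \<Rightarrow> real \<times> real \<Rightarrow> real \<Rightarrow> bool" where
  "has_interior_angle C p \<alpha> \<longleftrightarrow>
     (\<exists>\<phi> r. r > 0 \<and>
        (\<forall>\<rho> \<theta>. 0 < \<rho> \<and> \<rho> < r \<and> \<phi> \<le> \<theta> \<and> \<theta> < \<phi> + 2 * pi \<longrightarrow>
           (p + (\<rho> * cos \<theta>, \<rho> * sin \<theta>) \<in> inside C \<longleftrightarrow> \<phi> < \<theta> \<and> \<theta> < \<phi> + \<alpha>)))"

definition inner_corner :: "(real \<times> real) set \<Rightarrow> real \<times> real \<Rightarrow> bool" where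
  "inner_corner C p \<longleftrightarrow> corner C p \<and> has_interior_angle C p (3 * pi / 2)"

definition grid :: "nat \<Rightarrow> (real \<times> real) set" where
  "grid n = (real ` {1..n}) \<times> (real ` {1..n})"

definition covers :: "(real \<times> real) set set \<Rightarrow> (real \<times> real) set \<Rightarrow> bool" where
  "covers \<C> P \<longleftrightarrow> (\<forall>p\<in>P. \<exists>C\<in>\<C>. p \<in> C)"

end

(* Call a horizontal or vertical line that meets a curve in infinitely many points a level of the
   curve. Every non-extreme level of an orthoconvex curve carries an inner corner, so a curve with
   at most one inner corner has at most three levels in each direction, and a line that is not a
   level meets the curve in at most two points. Hence if 2m < n, every row and every column of the
   grid is a level of some curve, and it remains to show that the number of rows plus the number of
   columns is at most 5m. This is done by induction on m. A curve with at most five levels among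
   the rows and columns can be deleted together with them. Otherwise no curve leaves the bounding
   box of the grid, so a grid corner lies only on curves having both box sides through it as levels.
   Delete all curves that have a side of the box as a level, together with all their levels. A
   curve containing k <= 3 box corners has at least k + 1 sides of the box as levels (and k = 4
   would make it a rectangle), so sharing the four sides saves enough to average five lines per
   deleted curve. *)

theory Submission
  imports Defs
begin

section \<open>Levels of orthogonally convex regions\<close>

definition h_levels :: "(real \<times> real) set \<Rightarrow> real set" where
  "h_levels C = {c. infinite {x. (x, c) \<in> C}}"

definition v_levels :: "(real \<times> real) set \<Rightarrow> real set" where
  "v_levels C = {a. infinite {y. (a, y) \<in> C}}"

section \<open>Square boxes as neighbourhoods in the plane\<close>

lemma open_contains_box:
  fixes S :: "(real \<times> real) set"
  assumes "open S" "(x, y) \<in> S"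
  obtains d where "d > 0" "\<And>x' y'. \<bar>x' - x\<bar> < d \<Longrightarrow> \<bar>y' - y\<bar> < d \<Longrightarrow> (x', y') \<in> S"
proof -
  obtain A B where AB: "open A" "open B" "x \<in> A" "y \<in> B" "A \<times> B \<subseteq> S"
    using assms by (auto elim!: open_prod_elim)
  obtain d1 d2 where "d1 > 0" "\<And>x'. dist x' x < d1 \<Longrightarrow> x' \<in> A"
    "d2 > 0" "\<And>y'. dist y' y < d2 \<Longrightarrow> y' \<in> B"
    using AB(1-4) by (metis open_dist)
  with AB(5) have "min d1 d2 > 0"
    "\<And>x' y'. \<bar>x' - x\<bar> < min d1 d2 \<Longrightarrow> \<bar>y' - y\<bar> < min d1 d2 \<Longrightarrow> (x', y') \<in> S"
    by (auto simp: dist_real_def)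
  then show ?thesis using that by blast
qed

lemma in_closure_iff_box:
  fixes S :: "(real \<times> real) set"
  shows "(x, y) \<in> closure S \<longleftrightarrow>
    (\<forall>e>0. \<exists>x' y'. (x', y') \<in> S \<and> \<bar>x' - x\<bar> < e \<and> \<bar>y' - y\<bar> < e)"
proof
  assume L: "(x, y) \<in> closure S"
  show "\<forall>e>0. \<exists>x' y'. (x', y') \<in> S \<and> \<bar>x' - x\<bar> < e \<and> \<bar>y' - y\<bar> < e"
  proof (intro allI impI)
    fix e :: real assume "e > 0"
    then obtain q where q: "q \<in> S" "dist q (x, y) < e"
      using L by (metis closure_approachable)
    have "dist (fst q) x < e" "dist (snd q) y < e"
      using q(2) dist_fst_le[of q "(x,y)"] dist_snd_le[of q "(x,y)"] by auto
    then show "\<exists>x' y'. (x', y') \<in> S \<and> \<bar>x' - x\<bar> < e \<and> \<bar>y' - y\<bar> < e"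
      using q(1) by (intro exI[of _ "fst q"] exI[of _ "snd q"]) (auto simp: dist_real_def)
  qed
next
  assume R: "\<forall>e>0. \<exists>x' y'. (x', y') \<in> S \<and> \<bar>x' - x\<bar> < e \<and> \<bar>y' - y\<bar> < e"
  show "(x, y) \<in> closure S"
    unfolding closure_approachable
  proof (intro allI impI)
    fix e :: real assume "e > 0"
    then obtain x' y' where q: "(x', y') \<in> S" "\<bar>x' - x\<bar> < e/2" "\<bar>y' - y\<bar> < e/2"
      using R[rule_format, of "e/2"] by auto
    have "dist (x', y') (x, y) \<le> \<bar>x' - x\<bar> + \<bar>y' - y\<bar>"
      by (simp add: dist_Pair_Pair dist_real_def sqrt_sum_squares_le_sum_abs)
    then show "\<exists>q\<in>S. dist q (x, y) < e" using q by force
  qed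
qed

section \<open>Regions whose frontier is locally part of an axis-parallel cross\<close>

locale axis_region =
  fixes I :: "(real \<times> real) set"
  assumes open_I: "open I"
    and axis_local: "\<exists>e>0. \<forall>x y. (x, y) \<in> frontier I \<longrightarrow> \<bar>x - a\<bar> < e \<longrightarrow> \<bar>y - c\<bar> < e \<longrightarrow> x = a \<or> y = c"
begin

lemma frontier_iff: "p \<in> frontier I \<longleftrightarrow> p \<in> closure I \<and> p \<notin> I"
  using open_I by (simp add: frontier_def interior_open)

text \<open>A small open quadrant at \<open>(a, c)\<close> is connected and avoids both
  axis-parallel lines through \<open>(a, c)\<close>, hence the frontier, so it cannot meet both
  \<open>I\<close> and its complement.\<close>

lemma quadrant_dichotomy:
  "\<exists>e>0. \<forall>s\<in>{1, -1}. \<forall>t\<in>{1, -1}.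
      (\<forall>u v. 0 < u \<longrightarrow> u < e \<longrightarrow> 0 < v \<longrightarrow> v < e \<longrightarrow> (a + s * u, c + t * v) \<in> I) \<or>
      (\<forall>u v. 0 < u \<longrightarrow> u < e \<longrightarrow> 0 < v \<longrightarrow> v < e \<longrightarrow> (a + s * u, c + t * v) \<notin> I)"
proof -
  obtain e where e: "e > 0" "\<And>x y. (x, y) \<in> frontier I \<Longrightarrow> \<bar>x - a\<bar> < e \<Longrightarrow> \<bar>y - c\<bar> < e \<Longrightarrow> x = a \<or> y = c"
    using axis_local by blast
  have "(\<forall>u v. 0 < u \<longrightarrow> u < e \<longrightarrow> 0 < v \<longrightarrow> v < e \<longrightarrow> (a + s * u, c + t * v) \<in> I) \<or>
      (\<forall>u v. 0 < u \<longrightarrow> u < e \<longrightarrow> 0 < v \<longrightarrow> v < e \<longrightarrow> (a + s * u, c + t * v) \<notin> I)"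
    if st: "s \<in> {1, -1}" "t \<in> {1, -1}" for s t
  proof -
    define Q where "Q = (\<lambda>(u, v). (a + s * u, c + t * v)) ` ({0<..<e} \<times> {0<..<e})"
    have "connected Q"
      unfolding Q_def
      by (intro connected_continuous_image connected_Times connected_Ioo)
         (auto simp: case_prod_unfold intro!: continuous_intros)
    moreover have "Q \<inter> frontier I = {}"
    proof -
      have "(a + s * u, c + t * v) \<notin> frontier I" if "0 < u" "u < e" "0 < v" "v < e" for u v
        using e(2)[of "a + s * u" "c + t * v"] st that by auto
      then show ?thesis by (auto simp: Q_def)
    qed
    ultimately have Q: "Q \<inter> I = {} \<or> Q - I = {}"
      using connected_Int_frontier[of Q I] by blast
    have "(a + s * u, c + t * v) \<in> Q" if "0 < u" "u < e" "0 < v" "v < e" for u v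
      unfolding Q_def using that by (intro image_eqI[of _ _ "(u, v)"]) auto
    with Q show ?thesis by blast
  qed
  with e(1) show ?thesis by blast
qed

text \<open>As \<open>I\<close> is open, a point of \<open>I\<close> close to \<open>(a, c)\<close>
  can be shifted off both lines through \<open>(a, c)\<close>. It then lies in one of the four
  quadrants, and the dichotomy gives the whole quadrant.\<close>

lemma quadrant:
  assumes "(a, c) \<in> closure I"
  obtains e s t where "e > 0" "s \<in> {1, -1}" "t \<in> {1, -1}"
    "\<And>u v. 0 < u \<Longrightarrow> u < e \<Longrightarrow> 0 < v \<Longrightarrow> v < e \<Longrightarrow> (a + s * u, c + t * v) \<in> I"
proof -
  obtain e where e: "e > 0"
    and dich: "\<forall>s\<in>{1, -1}. \<forall>t\<in>{1, -1}.
      (\<forall>u v. 0 < u \<longrightarrow> u < e \<longrightarrow> 0 < v \<longrightarrow> v < e \<longrightarrow> (a + s * u, c + t * v) \<in> I) \<or>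
      (\<forall>u v. 0 < u \<longrightarrow> u < e \<longrightarrow> 0 < v \<longrightarrow> v < e \<longrightarrow> (a + s * u, c + t * v) \<notin> I)"
    using quadrant_dichotomy[of a c] by blast
  obtain x y where xy: "(x, y) \<in> I" "\<bar>x - a\<bar> < e" "\<bar>y - c\<bar> < e"
    using assms e by (auto simp: in_closure_iff_box)
  obtain d where d: "d > 0" "\<And>x' y'. \<bar>x' - x\<bar> < d \<Longrightarrow> \<bar>y' - y\<bar> < d \<Longrightarrow> (x', y') \<in> I"
    using open_contains_box[OF open_I xy(1)] by blast
  have nudge: "\<exists>x'. \<bar>x' - x\<bar> < d \<and> \<bar>x' - a\<bar> < e \<and> x' \<noteq> a" if "\<bar>x - a\<bar> < e" for x a
  proof (cases "x = a")
    case True then show ?thesis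
      using d(1) e by (intro exI[of _ "x + min d e / 2"]) (auto simp: min_def)
  next
    case False then show ?thesis using that d(1) by (intro exI[of _ x]) auto
  qed
  obtain x' where x': "\<bar>x' - x\<bar> < d" "\<bar>x' - a\<bar> < e" "x' \<noteq> a" using nudge xy(2) by blast
  obtain y' where y': "\<bar>y' - y\<bar> < d" "\<bar>y' - c\<bar> < e" "y' \<noteq> c" using nudge xy(3) by blast
  define s where "s = sgn (x' - a)"
  define t where "t = sgn (y' - c)"
  have st: "s \<in> {1, -1}" "t \<in> {1, -1}"
    using x' y' by (auto simp: s_def t_def sgn_if)
  have "(a + s * \<bar>x' - a\<bar>, c + t * \<bar>y' - c\<bar>) \<in> I"
    using d(2)[OF x'(1) y'(1)] by (simp add: s_def t_def sgn_mult_abs)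
  moreover have "0 < \<bar>x' - a\<bar>" "0 < \<bar>y' - c\<bar>" using x' y' by auto
  ultimately have "\<forall>u v. 0 < u \<longrightarrow> u < e \<longrightarrow> 0 < v \<longrightarrow> v < e \<longrightarrow> (a + s * u, c + t * v) \<in> I"
    using dich[rule_format, OF st] x'(2) y'(2) by blast
  then show ?thesis using that[OF e st] by blast
qed

end

text \<open>\<open>I\<close> is the open region enclosed by the curve \<open>frontier I\<close>. All assumptions are symmetric in the
  two coordinates, so that facts about columns follow from facts about rows.\<close>

locale ortho_region = axis_region +
  assumes conn: "connected I"
    and bdd: "bounded I"
    and nonempty: "I \<noteq> {}"
    and interior_closure: "interior (closure I) = I"
    and hconv: "(x1, c) \<in> closure I \<Longrightarrow> (x2, c) \<in> closure I \<Longrightarrow> x1 \<le> x \<Longrightarrow> x \<le> x2 \<Longrightarrow> (x, c) \<in> closure I"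
    and vconv: "(a, y1) \<in> closure I \<Longrightarrow> (a, y2) \<in> closure I \<Longrightarrow> y1 \<le> y \<Longrightarrow> y \<le> y2 \<Longrightarrow> (a, y) \<in> closure I"
    and on_level: "(x, y) \<in> frontier I \<Longrightarrow> x \<in> v_levels (frontier I) \<or> y \<in> h_levels (frontier I)"
    and finite_h: "finite (h_levels (frontier I))"
    and finite_v: "finite (v_levels (frontier I))"

section \<open>Invariance under exchanging the two coordinates\<close>

lemma mem_swap_image: "(x, y) \<in> prod.swap ` S \<longleftrightarrow> (y, x) \<in> S"
  by force

lemma closure_swap: "closure (prod.swap ` S) = prod.swap ` closure (S :: (real \<times> real) set)"
  by (auto simp: in_closure_iff_box mem_swap_image) blast+

lemma linear_swap: "linear (prod.swap :: real \<times> real \<Rightarrow> real \<times> real)"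
  by (rule linearI) (auto simp: prod.swap_def)

lemma interior_swap: "interior (prod.swap ` S) = prod.swap ` interior (S :: (real \<times> real) set)"
  by (intro interior_injective_linear_image linear_swap injI) auto

lemma frontier_swap: "frontier (prod.swap ` S) = prod.swap ` frontier (S :: (real \<times> real) set)"
  by (simp add: frontier_def closure_swap interior_swap image_set_diff)

lemma h_levels_swap: "h_levels (prod.swap ` C) = v_levels C"
  and v_levels_swap: "v_levels (prod.swap ` C) = h_levels C"
  by (simp_all add: h_levels_def v_levels_def mem_swap_image)

lemma axis_region_swap:
  assumes "axis_region I" shows "axis_region (prod.swap ` I)"
proof -
  interpret axis_region I by fact
  show ?thesis
  proof
    show "open (prod.swap ` I)"
      by (metis interior_swap interior_open open_I open_interior)
    show "\<exists>e>0. \<forall>x y. (x, y) \<in> frontier (prod.swap ` I) \<longrightarrow> \<bar>x - a\<bar> < e \<longrightarrow> \<bar>y - c\<bar> < e \<longrightarrow> x = a \<or> y = c" for a c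
      using axis_local[of c a] by (auto simp: frontier_swap mem_swap_image)
  qed
qed

lemma ortho_region_swap:
  assumes "ortho_region I" shows "ortho_region (prod.swap ` I)"
proof -
  interpret ortho_region I by fact
  interpret S: axis_region "prod.swap ` I"
    by (rule axis_region_swap) unfold_locales
  show ?thesis
  proof
    show "connected (prod.swap ` I)"
      using conn linear_swap linear_continuous_on linear_conv_bounded_linear
      by (intro connected_continuous_image) blast+
    show "bounded (prod.swap ` I)"
      using bdd linear_swap bounded_linear_image linear_conv_bounded_linear by blast
    show "prod.swap ` I \<noteq> {}" using nonempty by simp
    show "interior (closure (prod.swap ` I)) = prod.swap ` I"
      by (simp add: closure_swap interior_swap interior_closure)
  qed (auto simp: closure_swap frontier_swap mem_swap_image h_levels_swap v_levels_swap finite_h finite_v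
      intro: hconv vconv dest: on_level)
qed

section \<open>Rows of the region and its extreme levels\<close>

context ortho_region
begin

text \<open>Row convexity is given only for the closure. It passes to \<open>I\<close> because a
  whole open box around the segment lies in the closure, hence in
  \<open>interior (closure I)\<close>, which is \<open>I\<close>.\<close>

lemma hconv_I:
  assumes "(x1, c) \<in> I" "(x2, c) \<in> I" "x1 \<le> x" "x \<le> x2"
  shows "(x, c) \<in> I"
proof -
  obtain d1 where d1: "d1 > 0" "\<And>x' y'. \<bar>x' - x1\<bar> < d1 \<Longrightarrow> \<bar>y' - c\<bar> < d1 \<Longrightarrow> (x', y') \<in> I"
    using open_contains_box[OF open_I assms(1)] by blast
  obtain d2 where d2: "d2 > 0" "\<And>x' y'. \<bar>x' - x2\<bar> < d2 \<Longrightarrow> \<bar>y' - c\<bar> < d2 \<Longrightarrow> (x', y') \<in> I"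
    using open_contains_box[OF open_I assms(2)] by blast
  define d where "d = min d1 d2"
  have d: "d > 0" using d1 d2 by (simp add: d_def)
  let ?B = "{x1 - d<..<x2 + d} \<times> {c - d<..<c + d}"
  have "?B \<subseteq> closure I"
  proof clarify
    fix x' y' assume B: "x' \<in> {x1 - d<..<x2 + d}" "y' \<in> {c - d<..<c + d}"
    have y: "\<bar>y' - c\<bar> < d1" "\<bar>y' - c\<bar> < d2" using B by (auto simp: d_def)
    have x: "(x1, y') \<in> closure I" "(x2, y') \<in> closure I"
      using d1(2)[of x1 y'] d2(2)[of x2 y'] d1(1) d2(1) y closure_subset by auto
    consider "x' < x1" | "x' > x2" | "x1 \<le> x'" "x' \<le> x2" by linarith
    then show "(x', y') \<in> closure I"
    proof cases
      case 1
      then have "\<bar>x' - x1\<bar> < d1" using B by (auto simp: d_def)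
      then show ?thesis using d1(2)[OF _ y(1)] closure_subset by blast
    next
      case 2
      then have "\<bar>x' - x2\<bar> < d2" using B by (auto simp: d_def)
      then show ?thesis using d2(2)[OF _ y(2)] closure_subset by blast
    next
      case 3 then show ?thesis using hconv x by blast
    qed
  qed
  moreover have "open ?B" by (intro open_Times open_greaterThanLessThan)
  moreover have "(x, c) \<in> ?B" using assms d by auto
  ultimately have "(x, c) \<in> interior (closure I)" by (meson interior_maximal subsetD)
  then show ?thesis by (simp add: interior_closure)
qed

lemma vconv_I:
  assumes "(a, y1) \<in> I" "(a, y2) \<in> I" "y1 \<le> y" "y \<le> y2"
  shows "(a, y) \<in> I"
proof -
  interpret S: ortho_region "prod.swap ` I"
    by (rule ortho_region_swap) unfold_locales
  show ?thesis using S.hconv_I[of y1 a y2 y] assms by (simp add: mem_swap_image)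
qed

text \<open>The sign \<open>s\<close> is a direction along the row, so that later arguments treat
  left and right at once.\<close>

lemma hconv_I_signed:
  assumes "s \<in> {1, -1}" "(x + s * u1, c) \<in> I" "(x + s * u2, c) \<in> I" "u1 \<le> u" "u \<le> u2"
  shows "(x + s * u, c) \<in> I"
  using assms hconv_I[of "x + u1" c "x + u2" "x + u"] hconv_I[of "x - u2" c "x - u1" "x - u"]
  by auto

lemma hconv_signed:
  assumes "s \<in> {1, -1}" "(x + s * u1, c) \<in> closure I" "(x + s * u2, c) \<in> closure I" "u1 \<le> u" "u \<le> u2"
  shows "(x + s * u, c) \<in> closure I"
  using assms hconv[of "x + u1" c "x + u2" "x + u"] hconv[of "x - u2" c "x - u1" "x - u"]
  by auto

lemma vconv_I_signed:
  assumes "t \<in> {1, -1}" "(a, y + t * v1) \<in> I" "(a, y + t * v2) \<in> I" "v1 \<le> v" "v \<le> v2"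
  shows "(a, y + t * v) \<in> I"
  using assms vconv_I[of a "y + v1" "y + v2" "y + v"] vconv_I[of a "y - v2" "y - v1" "y - v"]
  by auto

text \<open>The middle point is not in \<open>I\<close>, so by convexity \<open>I\<close> cannot
  have points of the row on both sides of it. On a side without such points, everything up to the
  outer point is in the closure but not in \<open>I\<close>.\<close>

lemma frontier_gap:
  assumes "(x1, c) \<in> frontier I" "(x2, c) \<in> frontier I" "(x3, c) \<in> frontier I" "x1 < x2" "x2 < x3"
  shows "\<exists>u v. u < v \<and> (\<forall>x. u < x \<longrightarrow> x < v \<longrightarrow> (x, c) \<in> frontier I)"
proof -
  have "(\<forall>x. x1 < x \<longrightarrow> x < x2 \<longrightarrow> (x, c) \<notin> I) \<or> (\<forall>x. x2 < x \<longrightarrow> x < x3 \<longrightarrow> (x, c) \<notin> I)"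
    using hconv_I[of _ c _ x2] assms by (meson frontier_iff less_imp_le)
  moreover have "(x, c) \<in> closure I" if "x1 \<le> x" "x \<le> x3" for x
    using hconv[of x1 c x3 x] that assms by (simp add: frontier_iff)
  ultimately have "(\<forall>x. x1 < x \<longrightarrow> x < x2 \<longrightarrow> (x, c) \<in> frontier I) \<or> (\<forall>x. x2 < x \<longrightarrow> x < x3 \<longrightarrow> (x, c) \<in> frontier I)"
    using assms(4,5) by (auto simp: frontier_iff)
  then show ?thesis
    using assms(4,5) by blast
qed

text \<open>Any three frontier points on the row already yield a segment, by
  \<open>frontier_gap\<close>.\<close>

lemma h_level_segment:
  assumes "c \<in> h_levels (frontier I)"
  shows "\<exists>u v. u < v \<and> (\<forall>x. u < x \<longrightarrow> x < v \<longrightarrow> (x, c) \<in> frontier I)"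
proof -
  let ?S = "{x. (x, c) \<in> frontier I}"
  have inf: "infinite ?S" using assms by (simp add: h_levels_def)
  then obtain T where T: "T \<subseteq> ?S" "finite T" "card T = 3" by (metis infinite_arbitrarily_large)
  have "T - {Min T, Max T} \<noteq> {}"
  proof
    assume "T - {Min T, Max T} = {}"
    then have "card T \<le> card {Min T, Max T}" by (intro card_mono) auto
    also have "\<dots> \<le> 2" by (simp add: card_insert_if)
    finally show False using T(3) by simp
  qed
  then obtain x where x: "x \<in> T" "x \<noteq> Min T" "x \<noteq> Max T" by auto
  have "Min T \<in> T" "Max T \<in> T" "Min T < x" "x < Max T"
    using x Min_le[OF T(2) x(1)] Max_ge[OF T(2) x(1)] Min_in[OF T(2)] Max_in[OF T(2)] by auto
  with T x show ?thesis
    using frontier_gap[of "Min T" c x "Max T"] by blast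
qed

lemma card_h_section:
  assumes "c \<notin> h_levels (frontier I)"
  shows "finite {x. (x, c) \<in> frontier I}" "card {x. (x, c) \<in> frontier I} \<le> 2"
proof -
  let ?S = "{x. (x, c) \<in> frontier I}"
  show fin: "finite ?S" using assms by (simp add: h_levels_def)
  have "?S \<subseteq> {Min ?S, Max ?S}"
  proof (rule ccontr)
    assume "\<not> ?thesis"
    then obtain x where x: "x \<in> ?S" "x \<noteq> Min ?S" "x \<noteq> Max ?S" by auto
    have "Min ?S \<in> ?S" "Max ?S \<in> ?S" using Min_in[OF fin] Max_in[OF fin] x by auto
    moreover have "Min ?S < x" "x < Max ?S"
      using x Min_le[OF fin, of x] Max_ge[OF fin, of x] by auto
    ultimately obtain u v where uv: "u < v" "\<And>x. u < x \<Longrightarrow> x < v \<Longrightarrow> (x, c) \<in> frontier I"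
      using frontier_gap[of "Min ?S" c x "Max ?S"] x(1) by auto
    then have "{u<..<v} \<subseteq> ?S" by auto
    then show False using fin uv(1) by (meson finite_subset infinite_Ioo)
  qed
  then have "card ?S \<le> card {Min ?S, Max ?S}" by (intro card_mono) auto
  also have "\<dots> \<le> 2" by (simp add: card_insert_if)
  finally show "card ?S \<le> 2" .
qed

text \<open>The sign \<open>s\<close> selects the lowest or the highest row. A quadrant of
  \<open>I\<close> at an extreme point of the closure has its horizontal edge in the closure. No
  point of that row is in \<open>I\<close>, since openness would give a point beyond the extreme, so
  the edge lies in the frontier.\<close>

lemma extreme_h_level:
  assumes "s \<in> {1, -1 :: real}"
  obtains b where "b \<in> h_levels (frontier I)" "\<And>x y. (x, y) \<in> closure I \<Longrightarrow> s * b \<le> s * y"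
proof -
  have "compact (closure I)" "closure I \<noteq> {}" using bdd nonempty by (auto simp: compact_closure)
  then obtain p where p: "p \<in> closure I" "\<And>q. q \<in> closure I \<Longrightarrow> s * snd p \<le> s * snd q"
    using continuous_attains_inf[of "closure I" "\<lambda>p. s * snd p"]
      continuous_on_mult_left[OF continuous_on_snd[OF continuous_on_id], of "closure I" s] by auto
  obtain a b where ab: "p = (a, b)" by force
  have below: "(x, y) \<notin> I" if "s * y < s * b" for x y
    using p(2)[of "(x,y)"] that closure_subset ab by force
  obtain e r t where q: "e > 0" "r \<in> {1, -1 :: real}" "t \<in> {1, -1 :: real}"
    "\<And>u v. 0 < u \<Longrightarrow> u < e \<Longrightarrow> 0 < v \<Longrightarrow> v < e \<Longrightarrow> (a + r * u, b + t * v) \<in> I"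
    using quadrant[of a b] p(1) ab by blast
  have f: "(a + r * u, b) \<in> frontier I" if "0 < u" "u < e" for u
    unfolding frontier_iff
  proof
    show "(a + r * u, b) \<in> closure I"
      unfolding in_closure_iff_box
    proof (intro allI impI)
      fix d :: real assume "d > 0"
      then have "(a + r * u, b + t * (min d e / 2)) \<in> I"
        using q(1) that by (intro q(4)) (auto simp: min_def)
      then show "\<exists>x' y'. (x', y') \<in> I \<and> \<bar>x' - (a + r * u)\<bar> < d \<and> \<bar>y' - b\<bar> < d"
        using \<open>d > 0\<close> q(1,3) by (intro exI conjI) (auto simp: min_def)
    qed
    show "(a + r * u, b) \<notin> I"
    proof
      assume "(a + r * u, b) \<in> I"
      then obtain d where d: "d > 0" "\<And>x' y'. \<bar>x' - (a + r * u)\<bar> < d \<Longrightarrow> \<bar>y' - b\<bar> < d \<Longrightarrow> (x', y') \<in> I"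
        using open_contains_box[OF open_I] by blast
      have "(a + r * u, b - s * (d/2)) \<in> I" using d(1) assms by (intro d(2)) auto
      moreover have "s * (b - s * (d/2)) < s * b" using d(1) assms by auto
      ultimately show False using below by blast
    qed
  qed
  have "(\<lambda>u. a + r * u) ` {0<..<e} \<subseteq> {x. (x, b) \<in> frontier I}" using f by auto
  moreover have "infinite ((\<lambda>u. a + r * u) ` {0<..<e})"
    using q(1,2) by (subst finite_image_iff) (auto intro!: inj_onI simp: infinite_Ioo)
  ultimately have "b \<in> h_levels (frontier I)"
    unfolding h_levels_def using finite_subset by blast
  then show ?thesis using that p(2) ab by force
qed

lemma h_level_below:
  assumes "(x, y) \<in> frontier I" shows "\<exists>h\<in>h_levels (frontier I). h \<le> y"
  using extreme_h_level[of 1] assms frontier_iff by (metis insertI1 mult_1)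

lemma h_level_above:
  assumes "(x, y) \<in> frontier I" shows "\<exists>h\<in>h_levels (frontier I). y \<le> h"
  using extreme_h_level[of "-1"] assms frontier_iff by (metis insertI1 insertI2 mult_minus1 neg_le_iff_le)

end

section \<open>Inner corners\<close>

text \<open>Near \<open>(a, c)\<close> the region is the complement of a closed quadrant; \<open>s\<close> and \<open>t\<close> select the quadrant.\<close>

definition reflex_corner :: "(real \<times> real) set \<Rightarrow> real \<Rightarrow> real \<Rightarrow> bool" where
  "reflex_corner I a c \<longleftrightarrow> (\<exists>s\<in>{1, -1}. \<exists>t\<in>{1, -1}. \<exists>e>0. \<forall>u v. \<bar>u\<bar> < e \<longrightarrow> \<bar>v\<bar> < e \<longrightarrow>
     ((a + s * u, c + t * v) \<in> I \<longleftrightarrow> \<not> (0 \<le> u \<and> 0 \<le> v)))"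

lemma reflex_corner_swap: "reflex_corner (prod.swap ` I) c a \<longleftrightarrow> reflex_corner I a c"
proof -
  have "reflex_corner (prod.swap ` I) c a" if "reflex_corner I a c" for I a c
  proof -
    obtain s t e where st: "s \<in> {1, -1}" "t \<in> {1, -1}" "e > 0" and
      H: "\<And>u v. \<bar>u\<bar> < e \<Longrightarrow> \<bar>v\<bar> < e \<Longrightarrow> ((a + s * u, c + t * v) \<in> I \<longleftrightarrow> \<not> (0 \<le> u \<and> 0 \<le> v))"
      using \<open>reflex_corner I a c\<close> unfolding reflex_corner_def by blast
    have "\<forall>u v. \<bar>u\<bar> < e \<longrightarrow> \<bar>v\<bar> < e \<longrightarrow> ((c + t * u, a + s * v) \<in> prod.swap ` I \<longleftrightarrow> \<not> (0 \<le> u \<and> 0 \<le> v))"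
      using H by (auto simp: mem_swap_image)
    then show ?thesis
      unfolding reflex_corner_def using st by (intro bexI[of _ t] bexI[of _ s] exI[of _ e] conjI)
  qed
  from this[of I a c] this[of "prod.swap ` I" c a] show ?thesis
    by (auto simp: image_comp)
qed

section \<open>Reflex corners as inner corners\<close>

text \<open>This is the normal form of the missing quadrant: turned into the closed fourth quadrant,
  its complement is the open sector from angle 0 to 270 degrees.\<close>

lemma angle_sector:
  fixes \<psi> :: real
  assumes "0 \<le> \<psi>" "\<psi> < 2 * pi"
  shows "0 \<le> cos \<psi> \<and> sin \<psi> \<le> 0 \<longleftrightarrow> \<not> (0 < \<psi> \<and> \<psi> < 3 * pi / 2)"
proof -
  have eq: "sin (\<psi> - pi) = - sin \<psi>" "cos (\<psi> - pi) = - cos \<psi>" by (simp_all add: sin_diff cos_diff)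
  have eq': "cos (\<psi> - 2 * pi) = cos \<psi>" by (simp add: cos_diff)
  consider "\<psi> = 0" | "0 < \<psi>" "\<psi> < pi" | "pi \<le> \<psi>" "\<psi> < 3 * pi / 2" | "3 * pi / 2 \<le> \<psi>"
    using assms by linarith
  then show ?thesis
  proof cases
    case 2 then show ?thesis using sin_gt_zero[of \<psi>] by auto
  next
    case 3 then show ?thesis using cos_gt_zero_pi[of "\<psi> - pi"] eq by auto
  next
    case 4
    have "0 \<le> sin (\<psi> - pi)" by (rule sin_ge_zero) (use 4 assms pi_gt_zero in linarith)+
    moreover have "0 \<le> cos (\<psi> - 2 * pi)" by (rule cos_ge_zero) (use 4 assms pi_gt_zero in linarith)+
    ultimately
    show ?thesis using 4 eq eq' by auto
  qed auto
qed

text \<open>The direction \<phi> is the counterclockwise end of the missing quadrant, that is pi/2,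
  pi, 3 pi/2 or 0 according to the signs. Turning by -\<phi> reduces all four cases to
  \<open>angle_sector\<close>.\<close>

lemma reflex_corner_interior_angle:
  assumes "reflex_corner (inside C) a c"
  shows "has_interior_angle C (a, c) (3 * pi / 2)"
proof -
  obtain s t e where st: "s \<in> {1, -1}" "t \<in> {1, -1}" "e > 0" and
    H: "\<And>u v. \<bar>u\<bar> < e \<Longrightarrow> \<bar>v\<bar> < e \<Longrightarrow> ((a + s * u, c + t * v) \<in> inside C \<longleftrightarrow> \<not> (0 \<le> u \<and> 0 \<le> v))"
    using assms unfolding reflex_corner_def by blast
  have "\<exists>\<phi>. \<forall>\<theta>. \<phi> \<le> \<theta> \<longrightarrow> \<theta> < \<phi> + 2 * pi \<longrightarrow>
      (0 \<le> s * cos \<theta> \<and> 0 \<le> t * sin \<theta> \<longleftrightarrow> 0 \<le> cos (\<theta> - \<phi>) \<and> sin (\<theta> - \<phi>) \<le> 0)"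
  proof -
    consider "s = 1" "t = 1" | "s = -1" "t = 1" | "s = -1" "t = -1" | "s = 1" "t = -1"
      using st by auto
    then show ?thesis
    proof cases
      case 1 then show ?thesis by (intro exI[of _ "pi/2"]) (auto simp: sin_diff cos_diff)
    next
      case 2 then show ?thesis by (intro exI[of _ "pi"]) (auto simp: sin_diff cos_diff)
    next
      case 3
      have "cos (3 * pi / 2) = 0" "sin (3 * pi / 2) = -1"
        using cos_3over2_pi sin_3over2_pi by (simp_all add: mult.commute)
      with 3 show ?thesis by (intro exI[of _ "3 * pi / 2"]) (auto simp: sin_diff cos_diff)
    next
      case 4 then show ?thesis by (intro exI[of _ 0]) auto
    qed
  qed
  then obtain \<phi> where \<phi>: "\<And>\<theta>. \<phi> \<le> \<theta> \<Longrightarrow> \<theta> < \<phi> + 2 * pi \<Longrightarrow>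
      (0 \<le> s * cos \<theta> \<and> 0 \<le> t * sin \<theta> \<longleftrightarrow> 0 \<le> cos (\<theta> - \<phi>) \<and> sin (\<theta> - \<phi>) \<le> 0)"
    by blast
  have "(a, c) + (\<rho> * cos \<theta>, \<rho> * sin \<theta>) \<in> inside C \<longleftrightarrow> \<phi> < \<theta> \<and> \<theta> < \<phi> + 3 * pi / 2"
    if that: "0 < \<rho>" "\<rho> < e" "\<phi> \<le> \<theta>" "\<theta> < \<phi> + 2 * pi" for \<rho> \<theta>
  proof -
    \<comment> \<open>Because \<open>s\<close> and \<open>t\<close> have square 1, the polar point
      has the form treated by \<open>H\<close> with coordinates
      \<open>\<rho> * (s * cos \<theta>)\<close> and
      \<open>\<rho> * (t * sin \<theta>)\<close>.\<close>
    have "\<bar>\<rho> * (s * cos \<theta>)\<bar> \<le> \<rho>" "\<bar>\<rho> * (t * sin \<theta>)\<bar> \<le> \<rho>"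
      using that st abs_cos_le_one[of \<theta>] abs_sin_le_one[of \<theta>]
      by (auto simp: abs_mult mult_left_le)
    then have "(a + s * (\<rho> * (s * cos \<theta>)), c + t * (\<rho> * (t * sin \<theta>))) \<in> inside C
        \<longleftrightarrow> \<not> (0 \<le> \<rho> * (s * cos \<theta>) \<and> 0 \<le> \<rho> * (t * sin \<theta>))"
      using that by (intro H) auto
    moreover have "(a + s * (\<rho> * (s * cos \<theta>)), c + t * (\<rho> * (t * sin \<theta>))) = (a, c) + (\<rho> * cos \<theta>, \<rho> * sin \<theta>)"
      using st by auto
    moreover have "(0 \<le> \<rho> * (s * cos \<theta>) \<and> 0 \<le> \<rho> * (t * sin \<theta>)) \<longleftrightarrow> (0 \<le> s * cos \<theta> \<and> 0 \<le> t * sin \<theta>)"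
      using that(1) by (auto simp: zero_le_mult_iff)
    moreover have "0 \<le> cos (\<theta> - \<phi>) \<and> sin (\<theta> - \<phi>) \<le> 0 \<longleftrightarrow> \<not> (\<phi> < \<theta> \<and> \<theta> < \<phi> + 3 * pi / 2)"
      by (subst angle_sector) (use that in auto)
    ultimately show ?thesis
      using \<phi>[OF that(3,4)] by simp
  qed
  with st(3) show ?thesis
    unfolding has_interior_angle_def by (intro exI[of _ \<phi>] exI[of _ e] conjI allI impI) auto
qed

text \<open>The two edges of the missing closed quadrant are outside \<open>I\<close> but are
  approached by points of \<open>I\<close> across the edge, so both lie in the frontier.\<close>

lemma (in axis_region) reflex_corner_is_corner:
  assumes "reflex_corner I a c"
  shows "corner (frontier I) (a, c)"
proof -
  obtain s t e where st: "s \<in> {1, -1}" "t \<in> {1, -1}" "e > 0" and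
    H: "\<And>u v. \<bar>u\<bar> < e \<Longrightarrow> \<bar>v\<bar> < e \<Longrightarrow> ((a + s * u, c + t * v) \<in> I \<longleftrightarrow> \<not> (0 \<le> u \<and> 0 \<le> v))"
    using assms unfolding reflex_corner_def by blast
  have h: "(a + s * u, c) \<in> frontier I" if "0 \<le> u" "u < e" for u
    unfolding frontier_iff in_closure_iff_box
  proof (intro conjI allI impI)
    fix d :: real assume d: "d > 0"
    show "\<exists>x' y'. (x', y') \<in> I \<and> \<bar>x' - (a + s * u)\<bar> < d \<and> \<bar>y' - c\<bar> < d"
      using H[of u "- min e d / 2"] st(2,3) d that
      by (intro exI[of _ "a + s * u"] exI[of _ "c + t * (- min e d / 2)"]) (auto simp: min_def)
  next
    show "(a + s * u, c) \<notin> I" using H[of u 0] that by simp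
  qed
  have v: "(a, c + t * v) \<in> frontier I" if "0 \<le> v" "v < e" for v
    unfolding frontier_iff in_closure_iff_box
  proof (intro conjI allI impI)
    fix d :: real assume d: "d > 0"
    show "\<exists>x' y'. (x', y') \<in> I \<and> \<bar>x' - a\<bar> < d \<and> \<bar>y' - (c + t * v)\<bar> < d"
      using H[of "- min e d / 2" v] st(1,3) d that
      by (intro exI[of _ "a + s * (- min e d / 2)"] exI[of _ "c + t * v"]) (auto simp: min_def)
  next
    show "(a, c + t * v) \<notin> I" using H[of 0 v] that by simp
  qed
  have "closed_segment (a, c) (a + s * (e/2), c) \<subseteq> frontier I"
  proof
    fix p assume "p \<in> closed_segment (a, c) (a + s * (e/2), c)"
    then obtain w where w: "p = (a + s * (w * (e/2)), c)" "0 \<le> w" "w \<le> 1"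
      by (auto simp: in_segment algebra_simps)
    then have "0 \<le> w * (e/2)" "w * (e/2) < e"
      using st(3) mult_right_mono[of w 1 "e/2"] by auto
    then show "p \<in> frontier I" unfolding w(1) by (rule h)
  qed
  moreover have "closed_segment (a, c) (a, c + t * (e/2)) \<subseteq> frontier I"
  proof
    fix p assume "p \<in> closed_segment (a, c) (a, c + t * (e/2))"
    then obtain w where w: "p = (a, c + t * (w * (e/2)))" "0 \<le> w" "w \<le> 1"
      by (auto simp: in_segment algebra_simps)
    then have "0 \<le> w * (e/2)" "w * (e/2) < e"
      using st(3) mult_right_mono[of w 1 "e/2"] by auto
    then show "p \<in> frontier I" unfolding w(1) by (rule v)
  qed
  moreover have "a + s * (e/2) \<noteq> a" "c + t * (e/2) \<noteq> c" using st by auto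
  ultimately show ?thesis
    unfolding corner_def by (metis fst_conv snd_conv)
qed

section \<open>Reflex corners on non-extreme levels\<close>

context ortho_region
begin

text \<open>Next to a segment of the level, \<open>I\<close> lies on one side. Being connected and
  reaching both sides of the row, \<open>I\<close> also meets the row itself. On the way along the
  row from such a point to the segment, the first frontier point is the reflex corner.\<close>

lemma h_level_reflex_corner:
  assumes "c \<in> h_levels (frontier I)"
    and "(x1, y1) \<in> closure I" "y1 < c" and "(x2, y2) \<in> closure I" "c < y2"
  shows "\<exists>a. reflex_corner I a c"
proof -
  obtain p1 p2 where p: "p1 < p2" "\<And>x. p1 < x \<Longrightarrow> x < p2 \<Longrightarrow> (x, c) \<in> frontier I"
    using h_level_segment[OF assms(1)] by blast
  define m where "m = (p1 + p2) / 2"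
  have "(m, c) \<in> closure I" using p by (auto simp: m_def frontier_iff)
  then obtain e0 r t0 where q: "e0 > 0" "r \<in> {1, -1 :: real}" "t0 \<in> {1, -1 :: real}"
    "\<And>u v. 0 < u \<Longrightarrow> u < e0 \<Longrightarrow> 0 < v \<Longrightarrow> v < e0 \<Longrightarrow> (m + r * u, c + t0 * v) \<in> I"
    using quadrant by blast
  \<comment> \<open>With this \<open>\<eta>\<close>, the point \<open>x0\<close> stays on the level
    segment, and columns closer than \<open>\<eta>\<close> to \<open>x0\<close> stay within the
    quadrant found at \<open>m\<close>.\<close>
  define \<eta> where "\<eta> = min e0 (p2 - p1) / 4"
  define x0 where "x0 = m + r * \<eta>"
  \<comment> \<open>The direction \<open>t\<close> points away from the side on which
    \<open>I\<close> borders the segment, hence into the future missing quadrant.\<close>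
  define t where "t = - t0"
  have \<eta>: "\<eta> > 0" "\<eta> \<le> e0 / 4" "\<eta> \<le> (p2 - p1) / 4" using q(1) p(1) by (auto simp: \<eta>_def)
  have x0: "(x0, c) \<in> frontier I"
    using \<eta> p(1) q(2) by (intro p(2)) (auto simp: x0_def m_def field_simps)
  have below0: "(x, c - t * v) \<in> I" if "\<bar>x - x0\<bar> < \<eta>" "0 < v" "v < \<eta>" for x v
  proof -
    have "(m + r * (r * (x - m)), c + t0 * v) \<in> I"
      using that \<eta> q(2) by (intro q(4)) (auto simp: x0_def)
    then show ?thesis using q(2) by (auto simp: t_def)
  qed
  have t: "t \<in> {1, -1}" using q(3) by (auto simp: t_def)
  obtain zx where zx: "(zx, c) \<in> I"
  proof -
    obtain p where "p \<in> I" "snd p < c"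
      using assms(2,3) in_closure_iff_box[of x1 y1 I] by (metis abs_diff_less_iff diff_gt_0_iff_gt snd_conv add.commute diff_add_cancel)
    moreover obtain p' where "p' \<in> I" "c < snd p'"
      using assms(4,5) in_closure_iff_box[of x2 y2 I] by (metis abs_diff_less_iff diff_gt_0_iff_gt snd_conv diff_diff_eq2 add_diff_cancel_left')
    moreover have "connected (snd ` I)"
      using conn by (intro connected_continuous_image continuous_intros)
    ultimately have "c \<in> snd ` I"
      using connectedD_interval[of "snd ` I" "snd p" "snd p'" c] by auto
    then show ?thesis using that by force
  qed
  obtain dz where dz: "dz > 0" "\<And>x y. \<bar>x - zx\<bar> < dz \<Longrightarrow> \<bar>y - c\<bar> < dz \<Longrightarrow> (x, y) \<in> I"
    using open_contains_box[OF open_I zx] by blast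
  define s where "s = sgn (x0 - zx)"
  define d where "d = \<bar>x0 - zx\<bar>"
  have ne: "x0 \<noteq> zx" using zx x0 frontier_iff by auto
  then have s: "s \<in> {1, -1}" by (auto simp: s_def sgn_if)
  have d: "d > 0" "x0 = zx + s * d" using ne by (auto simp: d_def s_def sgn_if)
  \<comment> \<open>Distances from \<open>zx\<close> at which the frontier is met on the way to
    \<open>x0\<close>. The set is closed, so its infimum \<open>w0\<close> is attained, and
    \<open>qx\<close> is the first frontier point.\<close>
  define A where "A = {0..d} \<inter> (\<lambda>w. (zx + s * w, c)) -` frontier I"
  have "closed A"
    unfolding A_def by (intro continuous_closed_preimage continuous_intros) auto
  moreover have dA: "d \<in> A" using d x0 by (auto simp: A_def)
  moreover have bA: "bdd_below A" by (auto simp: A_def intro!: bdd_belowI[of _ 0])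
  ultimately have wA: "Inf A \<in> A" by (intro closed_contains_Inf) auto
  define w0 where "w0 = Inf A"
  define qx where "qx = zx + s * w0"
  have w0: "0 \<le> w0" "w0 \<le> d" "(qx, c) \<in> frontier I" using wA by (auto simp: A_def w0_def qx_def)
  have q_notin: "(qx, c) \<notin> I" using w0(3) frontier_iff by blast
  have w0_pos: "w0 > 0" using w0(1) q_notin zx by (cases "w0 = 0") (auto simp: qx_def)
  have zi: "(zx + s * w, c) \<in> I" if "0 \<le> w" "w < w0" for w
  proof -
    have "w \<notin> A" using that(2) bA cInf_lower[of w A] by (auto simp: w0_def)
    then have "(zx + s * w, c) \<notin> frontier I" using that w0 by (auto simp: A_def)
    moreover have "(zx + s * w, c) \<in> closure I"
      using hconv_signed[OF s, of zx 0 c d w] zx d x0 that w0 closure_subset frontier_iff by auto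
    ultimately show ?thesis by (simp add: frontier_iff)
  qed
  \<comment> \<open>A point of \<open>I\<close> on the row at or past \<open>qx\<close> would,
    together with \<open>zx\<close>, force \<open>qx\<close> into \<open>I\<close>.\<close>
  have beyond: "(zx + s * w, c) \<notin> I" if "w0 \<le> w" for w
    using hconv_I_signed[OF s, of zx 0 c w w0] zx that w0 q_notin by (auto simp: qx_def)
  \<comment> \<open>A strip of \<open>I\<close> on the side opposite to \<open>t\<close>, spanned
    between columns \<open>zx\<close> and slightly past \<open>x0\<close>. The margin
    \<open>\<eta> / 2\<close> covers the case that \<open>qx\<close> is \<open>x0\<close>
    itself.\<close>
  have below: "(zx + s * w, c - t * v) \<in> I" if "0 \<le> w" "w \<le> d + \<eta> / 2" "0 < v" "v < \<eta>" "v < dz" for w v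
  proof (rule hconv_I_signed[OF s])
    show "(zx + s * 0, c - t * v) \<in> I" using dz that t by auto
    show "(zx + s * (d + \<eta>/2), c - t * v) \<in> I"
      using that \<eta> s d by (intro below0) (auto simp: algebra_simps)
  qed (use that in auto)
  obtain e1 where e1: "e1 > 0"
    and dich: "\<forall>s\<in>{1, -1}. \<forall>t\<in>{1, -1}.
      (\<forall>u v. 0 < u \<longrightarrow> u < e1 \<longrightarrow> 0 < v \<longrightarrow> v < e1 \<longrightarrow> (qx + s * u, c + t * v) \<in> I) \<or>
      (\<forall>u v. 0 < u \<longrightarrow> u < e1 \<longrightarrow> 0 < v \<longrightarrow> v < e1 \<longrightarrow> (qx + s * u, c + t * v) \<notin> I)"
    using quadrant_dichotomy[of qx c] by blast
  define u1 where "u1 = min e1 w0 / 2"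
  have u1: "0 < u1" "u1 < e1" "u1 < w0" using e1 w0_pos by (auto simp: u1_def min_def)
  \<comment> \<open>Just before \<open>qx\<close> the row is in \<open>I\<close>, so by openness the
    quadrant behind \<open>qx\<close> on side \<open>t\<close> contains a point of \<open>I\<close>,
    and by the dichotomy it lies in \<open>I\<close>.\<close>
  have "(qx - s * u1, c) \<in> I"
    using zi[of "w0 - u1"] u1 by (simp add: qx_def algebra_simps)
  then obtain d1 where d1: "d1 > 0" "\<And>x y. \<bar>x - (qx - s * u1)\<bar> < d1 \<Longrightarrow> \<bar>y - c\<bar> < d1 \<Longrightarrow> (x, y) \<in> I"
    using open_contains_box[OF open_I] by blast
  define v1 where "v1 = min e1 d1 / 2"
  have v1: "0 < v1" "v1 < e1" "v1 < d1" using e1 d1 by (auto simp: v1_def min_def)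
  have "(qx + (- s) * u1, c + t * v1) \<in> I" using d1 v1 t by auto
  moreover have "- s \<in> {1, -1}" using s by auto
  ultimately have side: "(qx + (- s) * u, c + t * v) \<in> I" if "0 < u" "u < e1" "0 < v" "v < e1" for u v
    using dich[rule_format, of "- s" t] t u1 v1 that by blast
  define e where "e = min (min e1 (\<eta>/2)) (min w0 dz)"
  have e: "e > 0" "e \<le> e1" "e \<le> \<eta>/2" "e \<le> w0" "e \<le> dz" using e1 \<eta> w0_pos dz by (auto simp: e_def)
  have "(qx + s * u, c + t * v) \<in> I \<longleftrightarrow> \<not> (0 \<le> u \<and> 0 \<le> v)" if uv: "\<bar>u\<bar> < e" "\<bar>v\<bar> < e" for u v
  proof -
    have below': "(qx + s * u, c - t * v') \<in> I" if "0 < v'" "v' < e" for v'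
      using below[of "w0 + u" v'] that uv e w0 by (simp add: qx_def algebra_simps)
    consider "v < 0" | "0 \<le> u" "0 \<le> v" | "u < 0" "v = 0" | "u < 0" "0 < v" by linarith
    then show ?thesis
    proof cases
      case 1 then show ?thesis using below'[of "- v"] uv by simp
    next
      case 2
      \<comment> \<open>A point of \<open>I\<close> here and the strip on the other side would put
        the point of row \<open>c\<close> between them into \<open>I\<close>, against
        \<open>beyond\<close>.\<close>
      have "(qx + s * u, c + t * v) \<notin> I"
      proof
        assume "(qx + s * u, c + t * v) \<in> I"
        moreover have "(qx + s * u, c + t * (- (e/2))) \<in> I" using below'[of "e/2"] e by simp
        ultimately have "(qx + s * u, c + t * 0) \<in> I"
          using vconv_I_signed[OF t, of "qx + s * u" c "- (e/2)" v 0] 2 e by simp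
        then show False using beyond[of "w0 + u"] 2 by (simp add: qx_def algebra_simps)
      qed
      with 2 show ?thesis by simp
    next
      case 3 then show ?thesis using zi[of "w0 + u"] uv e by (simp add: qx_def algebra_simps)
    next
      case 4 then show ?thesis using side[of "- u" v] uv e by simp
    qed
  qed
  then show ?thesis
    unfolding reflex_corner_def using s t e(1) by blast
qed

text \<open>Apart from the lowest and the highest level, each level is the height of some reflex
  corner.\<close>

lemma card_h_levels_le_3:
  assumes "finite {p. reflex_corner I (fst p) (snd p)}" "card {p. reflex_corner I (fst p) (snd p)} \<le> 1"
  shows "card (h_levels (frontier I)) \<le> 3"
proof -
  let ?R = "{p. reflex_corner I (fst p) (snd p)}"
  obtain b where b: "b \<in> h_levels (frontier I)" "\<And>x y. (x, y) \<in> closure I \<Longrightarrow> b \<le> y"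
    using extreme_h_level[of 1] by auto
  obtain t where t: "t \<in> h_levels (frontier I)" "\<And>x y. (x, y) \<in> closure I \<Longrightarrow> y \<le> t"
    using extreme_h_level[of "-1"] by auto
  have pt: "\<exists>x. (x, c) \<in> closure I" if "c \<in> h_levels (frontier I)" for c
    using h_level_segment[OF that] by (meson dense frontier_iff)
  have "h_levels (frontier I) \<subseteq> {b, t} \<union> snd ` ?R"
  proof
    fix c assume c: "c \<in> h_levels (frontier I)"
    show "c \<in> {b, t} \<union> snd ` ?R"
    proof (cases "c = b \<or> c = t")
      case False
      then have "b < c" "c < t" using pt[OF c] b(2) t(2) by force+
      then obtain a where "reflex_corner I a c"
        using h_level_reflex_corner[OF c] pt[OF b(1)] pt[OF t(1)] by blast
      then show ?thesis by (auto intro!: image_eqI[of c snd "(a, c)"])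
    qed auto
  qed
  then have "card (h_levels (frontier I)) \<le> card ({b, t} \<union> snd ` ?R)"
    using assms(1) by (intro card_mono) auto
  also have "\<dots> \<le> card {b, t} + card (snd ` ?R)" by (rule card_Un_le)
  also have "\<dots> \<le> 2 + 1"
    using card_image_le[OF assms(1), of snd] assms(2) by (intro add_mono) (auto simp: card_insert_if)
  finally show ?thesis by simp
qed

section \<open>Column versions by reflection, and curves through all corners of a box\<close>

lemma swap_region: "ortho_region (prod.swap ` I)"
  by (rule ortho_region_swap) unfold_locales

lemma card_v_levels_le_3:
  assumes "finite {p. reflex_corner I (fst p) (snd p)}" "card {p. reflex_corner I (fst p) (snd p)} \<le> 1"
  shows "card (v_levels (frontier I)) \<le> 3"
proof -
  interpret S: ortho_region "prod.swap ` I" by (rule swap_region)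
  have "{p. reflex_corner (prod.swap ` I) (fst p) (snd p)} = prod.swap ` {p. reflex_corner I (fst p) (snd p)}"
    by (auto simp: reflex_corner_swap image_iff)
  then show ?thesis
    using S.card_h_levels_le_3 assms card_image_le[OF assms(1), of prod.swap]
    by (simp add: frontier_swap h_levels_swap)
qed

lemma card_v_section:
  assumes "a \<notin> v_levels (frontier I)"
  shows "finite {y. (a, y) \<in> frontier I}" "card {y. (a, y) \<in> frontier I} \<le> 2"
proof -
  interpret S: ortho_region "prod.swap ` I" by (rule swap_region)
  show "finite {y. (a, y) \<in> frontier I}" "card {y. (a, y) \<in> frontier I} \<le> 2"
    using S.card_h_section[of a] assms by (simp_all add: frontier_swap h_levels_swap mem_swap_image)
qed

lemma v_level_below:
  assumes "(x, y) \<in> frontier I" shows "\<exists>l\<in>v_levels (frontier I). l \<le> x"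
proof -
  interpret S: ortho_region "prod.swap ` I" by (rule swap_region)
  show ?thesis using S.h_level_below[of y x] assms by (simp add: frontier_swap h_levels_swap mem_swap_image)
qed

lemma v_level_above:
  assumes "(x, y) \<in> frontier I" shows "\<exists>l\<in>v_levels (frontier I). x \<le> l"
proof -
  interpret S: ortho_region "prod.swap ` I" by (rule swap_region)
  show ?thesis using S.h_level_above[of y x] assms by (simp add: frontier_swap h_levels_swap mem_swap_image)
qed

text \<open>By convexity in both directions the open box is contained in \<open>I\<close>. A row
  strictly between \<open>b\<close> and \<open>t\<close> then meets the frontier at most at
  \<open>l\<close> and \<open>r\<close>, so it is not a level.\<close>

lemma h_levels_of_box:
  assumes lr: "\<And>x. x \<in> v_levels (frontier I) \<Longrightarrow> l \<le> x \<and> x \<le> r"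
    and bt: "\<And>y. y \<in> h_levels (frontier I) \<Longrightarrow> b \<le> y \<and> y \<le> t"
    and corners: "(l, b) \<in> frontier I" "(l, t) \<in> frontier I" "(r, b) \<in> frontier I" "(r, t) \<in> frontier I"
  shows "h_levels (frontier I) \<subseteq> {b, t}"
proof
  fix c assume c: "c \<in> h_levels (frontier I)"
  show "c \<in> {b, t}"
  proof (rule ccontr)
    assume "c \<notin> {b, t}"
    with bt[OF c] have bct: "b < c" "c < t" by auto
    have "{l<..<r} \<times> {b<..<t} \<subseteq> closure I"
    proof clarify
      fix x y assume xy: "x \<in> {l<..<r}" "y \<in> {b<..<t}"
      have "(l, y) \<in> closure I" "(r, y) \<in> closure I"
        using vconv corners xy by (meson frontier_iff greaterThanLessThan_iff less_imp_le)+
      then show "(x, y) \<in> closure I"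
        using hconv xy by (meson greaterThanLessThan_iff less_imp_le)
    qed
    then have box: "{l<..<r} \<times> {b<..<t} \<subseteq> I"
      using interior_maximal[of "{l<..<r} \<times> {b<..<t}" "closure I"]
      by (simp add: interior_closure open_Times)
    have "{x. (x, c) \<in> frontier I} \<subseteq> {l, r}"
    proof (intro subsetI, rule ccontr)
      fix x assume "x \<in> {x. (x, c) \<in> frontier I}" and x': "x \<notin> {l, r}"
      then have x: "(x, c) \<in> frontier I" by simp
      obtain l' r' where "l' \<le> x" "l \<le> l'" "x \<le> r'" "r' \<le> r"
        using v_level_below[OF x(1)] v_level_above[OF x(1)] lr by blast
      then show False using x x' box bct frontier_iff[of "(x, c)"] by force
    qed
    then have "finite {x. (x, c) \<in> frontier I}" using finite_subset by blast
    then show False using c by (simp add: h_levels_def)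
  qed
qed

lemma card_levels_of_box:
  assumes lr: "\<And>x. x \<in> v_levels (frontier I) \<Longrightarrow> l \<le> x \<and> x \<le> r"
    and bt: "\<And>y. y \<in> h_levels (frontier I) \<Longrightarrow> b \<le> y \<and> y \<le> t"
    and corners: "(l, b) \<in> frontier I" "(l, t) \<in> frontier I" "(r, b) \<in> frontier I" "(r, t) \<in> frontier I"
  shows "card (h_levels (frontier I)) + card (v_levels (frontier I)) \<le> 4"
proof -
  interpret S: ortho_region "prod.swap ` I" by (rule swap_region)
  have "h_levels (frontier I) \<subseteq> {b, t}" by (rule h_levels_of_box) fact+
  then have "card (h_levels (frontier I)) \<le> card {b, t}" by (intro card_mono) auto
  moreover have "v_levels (frontier I) \<subseteq> {l, r}"
    using S.h_levels_of_box[of b t l r] assms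
    by (simp add: frontier_swap h_levels_swap v_levels_swap mem_swap_image)
  then have "card (v_levels (frontier I)) \<le> card {l, r}" by (intro card_mono) auto
  moreover have "card {b, t} \<le> 2" "card {l, r} \<le> 2" by (simp_all add: card_insert_if)
  ultimately show ?thesis by linarith
qed

end

section \<open>Counting levels\<close>

text \<open>The properties of a curve with at most one inner corner that the counting argument needs; the
  last one says that only a rectangle contains all four corners of its bounding box.\<close>

definition l_shaped :: "(real \<times> real) set \<Rightarrow> bool" where
  "l_shaped C \<longleftrightarrow> finite (h_levels C) \<and> finite (v_levels C) \<and> card (h_levels C) \<le> 3 \<and> card (v_levels C) \<le> 3 \<and>
    (\<forall>x y. (x, y) \<in> C \<longrightarrow> (x \<in> v_levels C \<or> y \<in> h_levels C) \<and>
      (\<exists>l\<in>v_levels C. l \<le> x) \<and> (\<exists>r\<in>v_levels C. x \<le> r) \<and>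
      (\<exists>b\<in>h_levels C. b \<le> y) \<and> (\<exists>t\<in>h_levels C. y \<le> t)) \<and>
    (\<forall>l r b t. (\<forall>x\<in>v_levels C. l \<le> x \<and> x \<le> r) \<longrightarrow> (\<forall>y\<in>h_levels C. b \<le> y \<and> y \<le> t) \<longrightarrow>
      {(l, b), (l, t), (r, b), (r, t)} \<subseteq> C \<longrightarrow> card (h_levels C) + card (v_levels C) \<le> 4)"

lemma l_shaped_box:
  assumes "l_shaped C"
    and "\<forall>x\<in>v_levels C. l \<le> x \<and> x \<le> r" "\<forall>y\<in>h_levels C. b \<le> y \<and> y \<le> t"
    and "(l, b) \<in> C" "(l, t) \<in> C" "(r, b) \<in> C" "(r, t) \<in> C"
  shows "card (h_levels C) + card (v_levels C) \<le> 4"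
proof -
  have "\<forall>l r b t. (\<forall>x\<in>v_levels C. l \<le> x \<and> x \<le> r) \<longrightarrow> (\<forall>y\<in>h_levels C. b \<le> y \<and> y \<le> t) \<longrightarrow>
      {(l, b), (l, t), (r, b), (r, t)} \<subseteq> C \<longrightarrow> card (h_levels C) + card (v_levels C) \<le> 4"
    using assms(1) unfolding l_shaped_def by (elim conjE)
  from this[rule_format, OF assms(2)[rule_format] assms(3)[rule_format]] show ?thesis
    using assms by simp
qed

section \<open>Cardinality estimates and the induction on the number of curves\<close>

lemma card_Diff_pair:
  assumes "finite H" "a \<noteq> b"
  shows "card (H - {a, b}) + of_bool (a \<in> H) + of_bool (b \<in> H) = card H"
proof -
  have "card H = card (H - {a, b}) + card (H \<inter> {a, b})"
    using assms(1) by (metis Diff_Diff_Int Int_lower1 card_Diff_subset card_mono le_add_diff_inverse2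
        finite_Int inf.commute Diff_subset finite_Diff add.commute)
  moreover have "card (H \<inter> {a, b}) = of_bool (a \<in> H) + of_bool (b \<in> H)"
    using assms(2) by (cases "a \<in> H"; cases "b \<in> H") auto
  ultimately show ?thesis by simp
qed

text \<open>This is the saving from shared sides: \<open>a\<close> and \<open>b\<close> are paid for
  once, not once per member of the family.\<close>

lemma card_UN_pair:
  fixes H :: "'i \<Rightarrow> 'a set"
  assumes "finite S" "\<And>C. C \<in> S \<Longrightarrow> finite (H C)"
  shows "card (\<Union>C\<in>S. H C) \<le> 2 + (\<Sum>C\<in>S. card (H C - {a, b}))"
proof -
  have "(\<Union>C\<in>S. H C) \<subseteq> {a, b} \<union> (\<Union>C\<in>S. H C - {a, b})" by auto
  then have "card (\<Union>C\<in>S. H C) \<le> card ({a, b} \<union> (\<Union>C\<in>S. H C - {a, b}))"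
    using assms by (intro card_mono) auto
  also have "\<dots> \<le> card {a, b} + card (\<Union>C\<in>S. H C - {a, b})" by (rule card_Un_le)
  also have "\<dots> \<le> 2 + (\<Sum>C\<in>S. card (H C - {a, b}))"
    using assms(1) by (intro add_mono card_UN_le) (auto simp: card_insert_if)
  finally show ?thesis .
qed

text \<open>Here \<open>h\<close> and \<open>v\<close> count the levels that are not box sides, so
  \<open>h + v\<close> is 6 minus the number of sides. The number of corners is smaller than that of
  sides: j sides with j = 1, 2, 3 have at most j - 1 corners among them, and four corners are
  excluded.\<close>

lemma sides_corners_count:
  fixes h v :: nat and L R B T lb lt rb rt :: bool
  assumes "h + of_bool B + of_bool T = 3" "v + of_bool L + of_bool R = 3"
    and "L \<or> R \<or> B \<or> T" "\<not> (lb \<and> lt \<and> rb \<and> rt)"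
    and "lb \<longrightarrow> L \<and> B" "lt \<longrightarrow> L \<and> T" "rb \<longrightarrow> R \<and> B" "rt \<longrightarrow> R \<and> T"
  shows "h + v + (of_bool lb + of_bool lt + of_bool rb + of_bool rt) \<le> 5"
  using assms by (cases L; cases R; cases B; cases T) (auto simp: of_bool_def)

text \<open>Strong induction on the number of curves. The sets \<open>X\<close> and \<open>Y\<close>
  are arbitrary because deleting rows and columns leaves a grid with uneven spacing.\<close>

lemma card_grid_lines_le:
  assumes "finite \<C>" "finite X" "finite Y"
    and "\<And>C. C \<in> \<C> \<Longrightarrow> l_shaped C"
    and "X \<times> Y \<subseteq> \<Union>\<C>"
    and "X \<subseteq> (\<Union>C\<in>\<C>. v_levels C)" and "Y \<subseteq> (\<Union>C\<in>\<C>. h_levels C)"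
  shows "card X + card Y \<le> 5 * card \<C>"
  using assms
proof (induction "card \<C>" arbitrary: \<C> X Y rule: less_induct)
  case less
  note fin = \<open>finite \<C>\<close> \<open>finite X\<close> \<open>finite Y\<close>
  note L = \<open>\<And>C. C \<in> \<C> \<Longrightarrow> l_shaped C\<close>
  have finH: "finite (h_levels C)" and finV: "finite (v_levels C)"
    and cardH: "card (h_levels C) \<le> 3" and cardV: "card (v_levels C) \<le> 3" if "C \<in> \<C>" for C
    using L[OF that] by (simp_all add: l_shaped_def)
  have on_level: "x \<in> v_levels C \<or> y \<in> h_levels C" if "C \<in> \<C>" "(x, y) \<in> C" for C x y
    using L[OF that(1)] that(2) unfolding l_shaped_def by blast
  \<comment> \<open>The deletion step. A grid point on a deleted curve lies on one of its levels and
    disappears with it, so the remaining curves cover the remaining grid.\<close>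
  have remove: ?case
    if S: "S \<subseteq> \<C>" "S \<noteq> {}"
      and le: "card (X \<inter> (\<Union>C\<in>S. v_levels C)) + card (Y \<inter> (\<Union>C\<in>S. h_levels C)) \<le> 5 * card S" for S
  proof -
    let ?X = "X - (\<Union>C\<in>S. v_levels C)" and ?Y = "Y - (\<Union>C\<in>S. h_levels C)"
    have finS: "finite S" using S(1) fin(1) finite_subset by blast
    have card_S: "card (\<C> - S) = card \<C> - card S" "card S > 0" "card S \<le> card \<C>"
      using S fin finS by (auto simp: card_Diff_subset card_gt_0_iff intro: card_mono)
    have "?X \<times> ?Y \<subseteq> \<Union>(\<C> - S)"
    proof clarify
      fix x y assume x: "x \<in> X" "x \<notin> (\<Union>C\<in>S. v_levels C)" and y: "y \<in> Y" "y \<notin> (\<Union>C\<in>S. h_levels C)"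
      then obtain C where "C \<in> \<C>" "(x, y) \<in> C" using less.prems(5) by blast
      with on_level x y show "(x, y) \<in> \<Union>(\<C> - S)" by blast
    qed
    moreover have "?X \<subseteq> (\<Union>C\<in>\<C> - S. v_levels C)" "?Y \<subseteq> (\<Union>C\<in>\<C> - S. h_levels C)"
      using less.prems(6,7) by blast+
    ultimately have "card ?X + card ?Y \<le> 5 * card (\<C> - S)"
      using card_S fin L by (intro less.hyps) auto
    moreover have "card X = card (X \<inter> (\<Union>C\<in>S. v_levels C)) + card ?X"
      "card Y = card (Y \<inter> (\<Union>C\<in>S. h_levels C)) + card ?Y"
      using fin by (metis Diff_disjoint Int_Diff_Un Int_Diff_disjoint card_Un_disjoint finite_Diff finite_Int)+
    ultimately show ?case using le card_S by linarith
  qed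
  show ?case
  \<comment> \<open>If one direction is empty, three levels per curve suffice for the other. A curve
    with at most five levels in the grid is deleted alone.\<close>
  proof (cases "X = {} \<or> Y = {} \<or> (\<exists>A\<in>\<C>. card (X \<inter> v_levels A) + card (Y \<inter> h_levels A) \<le> 5)")
    case True
    have cX: "card X \<le> 3 * card \<C>"
    proof -
      have "card X \<le> card (\<Union>C\<in>\<C>. v_levels C)" using less.prems(6) fin finV by (intro card_mono) auto
      also have "\<dots> \<le> (\<Sum>C\<in>\<C>. card (v_levels C))" using fin by (intro card_UN_le)
      also have "\<dots> \<le> (\<Sum>C\<in>\<C>. 3)" using cardV by (intro sum_mono) auto
      finally show ?thesis by simp
    qed
    have cY: "card Y \<le> 3 * card \<C>"
    proof -
      have "card Y \<le> card (\<Union>C\<in>\<C>. h_levels C)" using less.prems(7) fin finH by (intro card_mono) auto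
      also have "\<dots> \<le> (\<Sum>C\<in>\<C>. card (h_levels C))" using fin by (intro card_UN_le)
      also have "\<dots> \<le> (\<Sum>C\<in>\<C>. 3)" using cardH by (intro sum_mono) auto
      finally show ?thesis by simp
    qed
    from True show ?thesis
    proof (elim disjE bexE)
      fix A assume "A \<in> \<C>" "card (X \<inter> v_levels A) + card (Y \<inter> h_levels A) \<le> 5"
      then show ?thesis by (intro remove[of "{A}"]) auto
    qed (use cX cY in auto)
  next
    case False
    \<comment> \<open>Six levels in the grid is the maximum, so every curve has exactly three in
      each direction and all of them are grid lines.\<close>
    have full: "v_levels A \<subseteq> X" "card (v_levels A) = 3" "h_levels A \<subseteq> Y" "card (h_levels A) = 3" if A: "A \<in> \<C>" for A
    proof -
      have "card (X \<inter> v_levels A) \<le> card (v_levels A)" "card (Y \<inter> h_levels A) \<le> card (h_levels A)"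
        using finH[OF A] finV[OF A] by (auto intro: card_mono)
      moreover have "\<not> card (X \<inter> v_levels A) + card (Y \<inter> h_levels A) \<le> 5" using False A by blast
      ultimately have c: "card (X \<inter> v_levels A) = card (v_levels A)" "card (Y \<inter> h_levels A) = card (h_levels A)"
        "card (v_levels A) = 3" "card (h_levels A) = 3"
        using cardH[OF A] cardV[OF A] by linarith+
      show "card (v_levels A) = 3" "card (h_levels A) = 3" by fact+
      show "v_levels A \<subseteq> X" "h_levels A \<subseteq> Y"
        using card_subset_eq[OF finV[OF A], of "X \<inter> v_levels A"] card_subset_eq[OF finH[OF A], of "Y \<inter> h_levels A"] c
        by blast+
    qed
    define l where "l = Min X"
    define r where "r = Max X"
    define b where "b = Min Y"
    define t where "t = Max Y"
    have bounds: "\<And>x. x \<in> X \<Longrightarrow> l \<le> x \<and> x \<le> r" "\<And>y. y \<in> Y \<Longrightarrow> b \<le> y \<and> y \<le> t"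
      using fin by (auto simp: l_def r_def b_def t_def)
    have ext: "l \<in> X" "r \<in> X" "b \<in> Y" "t \<in> Y"
      using fin False by (auto simp: l_def r_def b_def t_def)
    obtain C0 where C0: "C0 \<in> \<C>" "(l, b) \<in> C0" using ext less.prems(5) by blast
    have "l \<noteq> r"
    proof
      assume "l = r"
      then have "v_levels C0 \<subseteq> {l}" using full(1)[OF C0(1)] bounds by force
      then have "card (v_levels C0) \<le> 1" using card_mono[of "{l}"] by force
      then show False using full(2)[OF C0(1)] by simp
    qed
    have "b \<noteq> t"
    proof
      assume "b = t"
      then have "h_levels C0 \<subseteq> {b}" using full(3)[OF C0(1)] bounds by force
      then have "card (h_levels C0) \<le> 1" using card_mono[of "{b}"] by force
      then show False using full(4)[OF C0(1)] by simp
    qed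
    \<comment> \<open>A curve has a level weakly to the left of each of its points. All levels lie
      in \<open>X\<close>, so on the left side of the box that level can only be
      \<open>l\<close>.\<close>
    have side_l: "l \<in> v_levels C" if "C \<in> \<C>" "(l, y) \<in> C" for C y
      using L[OF that(1)] that full(1)[OF that(1)] bounds(1) unfolding l_shaped_def
      by (metis order_antisym subsetD)
    have side_r: "r \<in> v_levels C" if "C \<in> \<C>" "(r, y) \<in> C" for C y
      using L[OF that(1)] that full(1)[OF that(1)] bounds(1) unfolding l_shaped_def
      by (metis order_antisym subsetD)
    have side_b: "b \<in> h_levels C" if "C \<in> \<C>" "(x, b) \<in> C" for C x
      using L[OF that(1)] that full(3)[OF that(1)] bounds(2) unfolding l_shaped_def
      by (metis order_antisym subsetD)
    have side_t: "t \<in> h_levels C" if "C \<in> \<C>" "(x, t) \<in> C" for C x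
      using L[OF that(1)] that full(3)[OF that(1)] bounds(2) unfolding l_shaped_def
      by (metis order_antisym subsetD)
    have not_all: "\<not> ((l, b) \<in> C \<and> (l, t) \<in> C \<and> (r, b) \<in> C \<and> (r, t) \<in> C)" if "C \<in> \<C>" for C
    proof
      assume "(l, b) \<in> C \<and> (l, t) \<in> C \<and> (r, b) \<in> C \<and> (r, t) \<in> C"
      moreover have "\<forall>x\<in>v_levels C. l \<le> x \<and> x \<le> r" "\<forall>y\<in>h_levels C. b \<le> y \<and> y \<le> t"
        using full(1,3)[OF that] bounds by blast+
      ultimately have "card (h_levels C) + card (v_levels C) \<le> 4"
        using l_shaped_box[OF L[OF that]] by simp
      then show False using full(2,4)[OF that] by simp
    qed
    define S where "S = {C \<in> \<C>. l \<in> v_levels C \<or> r \<in> v_levels C \<or> b \<in> h_levels C \<or> t \<in> h_levels C}"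
    have S: "S \<subseteq> \<C>" "finite S" using fin by (auto simp: S_def)
    define h' where "h' C = card (h_levels C - {b, t})" for C
    define v' where "v' C = card (v_levels C - {l, r})" for C
    define k :: "real \<times> real \<Rightarrow> (real \<times> real) set \<Rightarrow> nat" where "k p C = of_bool (p \<in> C)" for p C
    \<comment> \<open>Each box corner is a grid point. A curve covering it has the box sides through
      it as levels and thus belongs to \<open>S\<close>.\<close>
    have k_ge: "1 \<le> (\<Sum>C\<in>S. k p C)" if p: "p \<in> {(l, b), (l, t), (r, b), (r, t)}" for p
    proof -
      obtain C where C: "C \<in> \<C>" "p \<in> C" using ext less.prems(5) p by blast
      then have "C \<in> S" using p side_l side_r by (auto simp: S_def)
      then have "k p C \<le> (\<Sum>C\<in>S. k p C)" using S(2) by (intro member_le_sum) auto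
      then show ?thesis using C by (simp add: k_def)
    qed
    have each: "h' C + v' C + (k (l, b) C + k (l, t) C + k (r, b) C + k (r, t) C) \<le> 5" if "C \<in> S" for C
    proof -
      have C: "C \<in> \<C>" using that S by blast
      have eqs: "h' C + of_bool (b \<in> h_levels C) + of_bool (t \<in> h_levels C) = 3"
        "v' C + of_bool (l \<in> v_levels C) + of_bool (r \<in> v_levels C) = 3"
        unfolding h'_def v'_def
        using card_Diff_pair[OF finH[OF C] \<open>b \<noteq> t\<close>] card_Diff_pair[OF finV[OF C] \<open>l \<noteq> r\<close>] full(2,4)[OF C]
        by simp_all
      have "l \<in> v_levels C \<or> r \<in> v_levels C \<or> b \<in> h_levels C \<or> t \<in> h_levels C" using that by (simp add: S_def)
      moreover have "(l, b) \<in> C \<longrightarrow> l \<in> v_levels C \<and> b \<in> h_levels C" "(l, t) \<in> C \<longrightarrow> l \<in> v_levels C \<and> t \<in> h_levels C"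
        "(r, b) \<in> C \<longrightarrow> r \<in> v_levels C \<and> b \<in> h_levels C" "(r, t) \<in> C \<longrightarrow> r \<in> v_levels C \<and> t \<in> h_levels C"
        using side_l side_r side_b side_t C by blast+
      ultimately show ?thesis
        unfolding k_def using eqs not_all[OF C] by (intro sides_corners_count)
    qed
    \<comment> \<open>The four corners contribute at least 4 to the sum of the bounds
      \<open>each\<close>; this pays for the four box sides, which \<open>card_UN_pair\<close>
      counts as 2 + 2.\<close>
    have "4 + (\<Sum>C\<in>S. h' C + v' C) \<le> (\<Sum>C\<in>S. h' C + v' C + (k (l, b) C + k (l, t) C + k (r, b) C + k (r, t) C))"
      using k_ge[of "(l, b)"] k_ge[of "(l, t)"] k_ge[of "(r, b)"] k_ge[of "(r, t)"] by (simp add: sum.distrib)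
    also have "\<dots> \<le> (\<Sum>C\<in>S. 5)" by (intro sum_mono each)
    finally have total: "4 + (\<Sum>C\<in>S. h' C + v' C) \<le> 5 * card S" by simp
    have "card (\<Union>C\<in>S. h_levels C) \<le> 2 + (\<Sum>C\<in>S. h' C)" "card (\<Union>C\<in>S. v_levels C) \<le> 2 + (\<Sum>C\<in>S. v' C)"
      unfolding h'_def v'_def
      using card_UN_pair[of S h_levels b t] card_UN_pair[of S v_levels l r] S finH finV by blast+
    moreover have "card (X \<inter> (\<Union>C\<in>S. v_levels C)) \<le> card (\<Union>C\<in>S. v_levels C)"
      "card (Y \<inter> (\<Union>C\<in>S. h_levels C)) \<le> card (\<Union>C\<in>S. h_levels C)"
      using S finH finV by (auto intro!: card_mono)
    ultimately have "card (X \<inter> (\<Union>C\<in>S. v_levels C)) + card (Y \<inter> (\<Union>C\<in>S. h_levels C)) \<le> 5 * card S"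
      using total by (simp add: sum.distrib)
    moreover have "C0 \<in> S" using C0 side_l by (auto simp: S_def)
    ultimately show ?thesis using S(1) by (intro remove[of S]) auto
  qed
qed

section \<open>The region enclosed by an orthoconvex curve\<close>

text \<open>\<open>Jordan_curve\<close> concerns paths in the complex plane; the linear bijections
  \<open>f\<close> and \<open>k\<close> carry it over.\<close>

lemma jordan_plane:
  assumes "simple_closed_curve C"
  obtains I U where "I \<noteq> {}" "open I" "connected I" "bounded I" "connected U" "\<not> bounded U"
    "I \<inter> U = {}" "I \<union> U = - C" "frontier I = C" "C \<subseteq> closure U" "compact C" "connected C"
proof -
  obtain g where g: "simple_path g" "pathfinish g = pathstart g" "path_image g = C"
    using assms by (auto simp: simple_closed_curve_def)
  define f where "f p = Complex (fst p) (snd p)" for p :: "real \<times> real"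
  define k where "k z = (Re z, Im z)" for z
  have lf: "linear f" by (rule linearI) (auto simp: f_def complex_eq_iff)
  have lk: "linear k" by (rule linearI) (auto simp: k_def)
  have kf [simp]: "k (f p) = p" "f (k z) = z" for p z by (auto simp: k_def f_def)
  have inj: "inj f" "inj k" "surj k" by (metis injI kf(1), metis injI kf(2), metis surjI kf(1))
  have "simple_path (f \<circ> g)" using g lf inj by (simp add: simple_path_linear_image_eq)
  moreover have "pathfinish (f \<circ> g) = pathstart (f \<circ> g)"
    using g by (simp add: pathfinish_compose pathstart_compose)
  ultimately obtain inner outer where J: "inner \<noteq> {}" "open inner" "connected inner"
                "outer \<noteq> {}" "open outer" "connected outer"
                "bounded inner" "\<not> bounded outer" "inner \<inter> outer = {}"
                "inner \<union> outer = - path_image (f \<circ> g)"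
                "frontier inner = path_image (f \<circ> g)"
                "frontier outer = path_image (f \<circ> g)"
    by (rule Jordan_curve)
  have img: "k ` path_image (f \<circ> g) = C" using g by (simp add: path_image_compose image_image)
  have cont: "continuous_on A k" "continuous_on B f" for A B
    using lk lf by (auto simp: linear_continuous_on linear_conv_bounded_linear)
  have op: "open (k ` inner)" using J(2) lk inj(3) by (intro open_surjective_linear_image) auto
  show ?thesis
  proof
    show "k ` inner \<noteq> {}" using J by simp
    show "open (k ` inner)" by fact
    show "connected (k ` inner)" "connected (k ` outer)" using J cont by (auto intro: connected_continuous_image)
    show "bounded (k ` inner)" using J lk bounded_linear_image linear_conv_bounded_linear by blast
    show "\<not> bounded (k ` outer)"
    proof
      assume "bounded (k ` outer)"
      then have "bounded (f ` k ` outer)" using lf bounded_linear_image linear_conv_bounded_linear by blast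
      then show False using J by (simp add: image_image)
    qed
    show "k ` inner \<inter> k ` outer = {}" using J inj by (auto simp: inj_eq)
    show "k ` inner \<union> k ` outer = - C"
      using J(10) img inj by (metis image_Un bij_image_Compl_eq bij_def)
    have cl: "closure (k ` T) = k ` closure T" for T
      using closure_injective_linear_image[OF lk inj(2)] by simp
    show "frontier (k ` inner) = C"
      using J(2,11) op img inj by (simp add: frontier_def interior_open cl image_set_diff[OF inj(2), symmetric])
    have "path_image (f \<circ> g) \<subseteq> closure outer" using J(12) by (auto simp: frontier_def)
    then show "C \<subseteq> closure (k ` outer)" unfolding cl img[symmetric] by blast
    show "compact C" "connected C"
      using g compact_simple_path_image connected_simple_path_image by blast+
  qed
qed

section \<open>Local structure and levels of rectilinear sets\<close>

lemma fst_in_segment: "q \<in> closed_segment a b \<Longrightarrow> fst a = fst b \<Longrightarrow> fst q = fst b"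
  and snd_in_segment: "q \<in> closed_segment a b \<Longrightarrow> snd a = snd b \<Longrightarrow> snd q = snd b"
  for q :: "real \<times> real"
proof -
  assume "q \<in> closed_segment a b"
  then obtain u where "q = (1 - u) *\<^sub>R a + u *\<^sub>R b" by (auto simp: in_segment)
  then have "fst q = (1 - u) * fst a + u * fst b" "snd q = (1 - u) * snd a + u * snd b" by simp_all
  then show "fst a = fst b \<Longrightarrow> fst q = fst b" "snd a = snd b \<Longrightarrow> snd q = snd b"
    by (simp_all add: algebra_simps)
qed

text \<open>Segments through \<open>(a, c)\<close> lie on one of its two axis-parallel lines. The
  finitely many others are closed and stay away from a neighbourhood.\<close>

lemma rectilinear_local:
  assumes "rectilinear C"
  shows "\<exists>e>0. \<forall>x y. (x, y) \<in> C \<longrightarrow> \<bar>x - a\<bar> < e \<longrightarrow> \<bar>y - c\<bar> < e \<longrightarrow> x = a \<or> y = c"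
proof -
  obtain F where F: "finite F" "C = \<Union>F"
    "\<And>s. s \<in> F \<Longrightarrow> \<exists>a b. s = closed_segment a b \<and> (fst a = fst b \<or> snd a = snd b)"
    using assms by (auto simp: rectilinear_def)
  let ?p = "(a, c)"
  have "eventually (\<lambda>q. q \<in> s \<longrightarrow> fst q = a \<or> snd q = c) (nhds ?p)" if "s \<in> F" for s
  proof (cases "?p \<in> s")
    case True
    obtain p q where s: "s = closed_segment p q" "fst p = fst q \<or> snd p = snd q" using F(3)[OF \<open>s \<in> F\<close>] by blast
    have "r \<in> s \<longrightarrow> fst r = a \<or> snd r = c" for r
      using s fst_in_segment[of "?p" p q] snd_in_segment[of "?p" p q]
        fst_in_segment[of r p q] snd_in_segment[of r p q] True by auto
    then show ?thesis by simp
  next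
    case False
    moreover have "open (- s)" using F(3)[OF that] by (metis closed_segment open_Compl)
    ultimately have "eventually (\<lambda>q. q \<in> - s) (nhds ?p)" by (intro eventually_nhds_in_open) auto
    then show ?thesis by eventually_elim auto
  qed
  then have "eventually (\<lambda>q. \<forall>s\<in>F. q \<in> s \<longrightarrow> fst q = a \<or> snd q = c) (nhds ?p)"
    using F(1) by (intro eventually_ball_finite) auto
  then obtain S where S: "open S" "?p \<in> S" "\<And>q. q \<in> S \<Longrightarrow> q \<in> C \<Longrightarrow> fst q = a \<or> snd q = c"
    unfolding eventually_nhds F(2) by blast
  then obtain e where "e > 0" "\<And>x' y'. \<bar>x' - a\<bar> < e \<Longrightarrow> \<bar>y' - c\<bar> < e \<Longrightarrow> (x', y') \<in> S"
    using open_contains_box[OF S(1,2)] by blast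
  then show ?thesis using S(3) by (metis fst_conv snd_conv)
qed

lemma rectilinear_swap:
  assumes "rectilinear C" shows "rectilinear (prod.swap ` C)"
proof -
  obtain F where F: "finite F" "C = \<Union>F"
    "\<And>s. s \<in> F \<Longrightarrow> \<exists>a b. s = closed_segment a b \<and> (fst a = fst b \<or> snd a = snd b)"
    using assms by (auto simp: rectilinear_def)
  have "\<exists>a b. prod.swap ` s = closed_segment a b \<and> (fst a = fst b \<or> snd a = snd b)" if s: "s \<in> F" for s
  proof -
    obtain a b where "s = closed_segment a b" "fst a = fst b \<or> snd a = snd b" using F(3)[OF s] by blast
    then show ?thesis
      using closed_segment_linear_image[OF linear_swap, of a b]
      by (intro exI[of _ "prod.swap a"] exI[of _ "prod.swap b"]) auto
  qed
  moreover have "prod.swap ` C = \<Union>((`) prod.swap ` F)" using F(2) by blast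
  ultimately show ?thesis
    unfolding rectilinear_def using F(1) by (intro exI[of _ "(`) prod.swap ` F"]) auto
qed

lemma finite_h_levels:
  assumes "rectilinear C" shows "finite (h_levels C)"
proof -
  obtain F where F: "finite F" "C = \<Union>F"
    "\<And>s. s \<in> F \<Longrightarrow> \<exists>a b. s = closed_segment a b \<and> (fst a = fst b \<or> snd a = snd b)"
    using assms by (auto simp: rectilinear_def)
  \<comment> \<open>A level shares infinitely many points with one of the finitely many segments.
    That segment is not vertical, so it has a single height, which the choice recovers.\<close>
  have "h_levels C \<subseteq> (\<lambda>s. SOME c. \<exists>x. (x, c) \<in> s) ` F"
  proof
    fix c assume "c \<in> h_levels C"
    then have "infinite (\<Union>s\<in>F. {x. (x, c) \<in> s})"
      by (auto simp: h_levels_def F(2) Collect_bex_eq)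
    then obtain s where s: "s \<in> F" "infinite {x. (x, c) \<in> s}" using F(1) by auto
    obtain a b where ab: "s = closed_segment a b" "fst a = fst b \<or> snd a = snd b" using F(3)[OF s(1)] by blast
    have "fst a \<noteq> fst b"
    proof
      assume "fst a = fst b"
      then have "{x. (x, c) \<in> s} \<subseteq> {fst b}" unfolding ab(1)
        using fst_in_segment[of "(x, c)" a b for x] by auto
      with s(2) show False using finite_subset by blast
    qed
    then have level: "c' = snd b" if "(x, c') \<in> s" for x c'
      using snd_in_segment[of "(x, c')" a b] ab that by simp
    obtain x where x: "(x, c) \<in> s" using not_finite_existsD[OF s(2)] by blast
    then have "\<exists>x. (x, SOME c. \<exists>x. (x, c) \<in> s) \<in> s" by (intro someI[of "\<lambda>c. \<exists>x. (x, c) \<in> s" c] exI)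
    then have "(SOME c. \<exists>x. (x, c) \<in> s) = snd b" using level by (elim exE)
    then have "c = (SOME c. \<exists>x. (x, c) \<in> s)" using level[OF x] by simp
    then show "c \<in> (\<lambda>s. SOME c. \<exists>x. (x, c) \<in> s) ` F" using s(1) by blast
  qed
  then show ?thesis using F(1) finite_subset by blast
qed

lemma finite_v_levels:
  assumes "rectilinear C" shows "finite (v_levels C)"
  using finite_h_levels[OF rectilinear_swap[OF assms]] by (simp add: h_levels_swap)

text \<open>Near the point, the set lies on the two axis-parallel lines through it. If neither were
  a level, only finitely many points would be nearby, and the point would not be a limit
  point.\<close>

lemma rectilinear_on_level:
  assumes "rectilinear C" "(x, y) islimpt C"
  shows "x \<in> v_levels C \<or> y \<in> h_levels C"
proof (rule ccontr)
  assume "\<not> ?thesis"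
  then have fin: "finite {y'. (x, y') \<in> C}" "finite {x'. (x', y) \<in> C}" by (auto simp: v_levels_def h_levels_def)
  obtain e where e: "e > 0" "\<And>x' y'. (x', y') \<in> C \<Longrightarrow> \<bar>x' - x\<bar> < e \<Longrightarrow> \<bar>y' - y\<bar> < e \<Longrightarrow> x' = x \<or> y' = y"
    using rectilinear_local[OF assms(1)] by metis
  have "C \<inter> ball (x, y) e \<subseteq> Pair x ` {y'. (x, y') \<in> C} \<union> (\<lambda>x'. (x', y)) ` {x'. (x', y) \<in> C}"
  proof clarify
    fix x' y' assume p: "(x', y') \<in> C" "(x', y') \<in> ball (x, y) e" "(x', y') \<notin> (\<lambda>x'. (x', y)) ` {x'. (x', y) \<in> C}"
    have "dist x x' < e" "dist y y' < e"
      using p(2) dist_fst_le[of "(x, y)" "(x', y')"] dist_snd_le[of "(x, y)" "(x', y')"] by auto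
    then have "x' = x \<or> y' = y" using p(1) by (intro e(2)) (auto simp: dist_real_def)
    then show "(x', y') \<in> Pair x ` {y'. (x, y') \<in> C}" using p(1,3) by auto
  qed
  then have "finite (C \<inter> ball (x, y) e)" using fin finite_subset by blast
  then show False using assms(2) e(1) by (auto simp: islimpt_eq_infinite_ball)
qed

section \<open>Orthogonal convex hulls and the enclosed region\<close>

text \<open>The hull being proper guarantees that the intersected family is nonempty, as the empty
  intersection is \<open>UNIV\<close>. Sections of the hull are then intersections of segments,
  points or empty sets.\<close>

lemma hull_section:
  assumes "orthogonal_convex_hull S \<noteq> UNIV" "l = {p. snd p = c} \<or> l = {p. fst p = c}"
  shows "closed (orthogonal_convex_hull S \<inter> l)" "convex (orthogonal_convex_hull S \<inter> l)"
    "bounded (orthogonal_convex_hull S \<inter> l)"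
proof -
  let ?K = "{K. S \<subseteq> K \<and> connected K \<and> orthogonally_convex K}"
  have ne: "?K \<noteq> {}" using assms(1) unfolding orthogonal_convex_hull_def by (metis Inf_empty)
  have sec: "closed (K \<inter> l) \<and> convex (K \<inter> l) \<and> bounded (K \<inter> l)" if "K \<in> ?K" for K
  proof -
    have "K \<inter> l = {} \<or> (\<exists>p. K \<inter> l = {p}) \<or> (\<exists>a b. K \<inter> l = closed_segment a b)"
      using that assms(2) unfolding orthogonally_convex_def by blast
    then show ?thesis by (elim disjE exE) (simp_all add: bounded_closed_segment)
  qed
  have eq: "orthogonal_convex_hull S \<inter> l = (\<Inter>K\<in>?K. K \<inter> l)"
    using ne unfolding orthogonal_convex_hull_def by blast
  show "closed (orthogonal_convex_hull S \<inter> l)" "convex (orthogonal_convex_hull S \<inter> l)"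
    unfolding eq by (rule closed_INT, use sec in blast) (rule convex_INT, use sec in blast)
  obtain K where "K \<in> ?K" using ne by blast
  then have "bounded (K \<inter> l)" "orthogonal_convex_hull S \<inter> l \<subseteq> K \<inter> l" using sec unfolding eq by blast+
  then show "bounded (orthogonal_convex_hull S \<inter> l)" by (rule bounded_subset)
qed

text \<open>The hull \<open>K\<close> is not known to be closed, but its sections by axis-parallel lines are. On a horizontal
  line that is not a level, this puts the points of the curve into \<open>K\<close>, hence the enclosed region
  meets \<open>K\<close>, and \<open>K\<close> turns out to be its closure.\<close>

lemma orthoconvex_curve_region:
  assumes "orthoconvex_curve C"
  shows "ortho_region (inside C)" "frontier (inside C) = C"
proof -
  obtain S where rect: "rectilinear C" and scc: "simple_closed_curve C" and S: "C = frontier (orthogonal_convex_hull S)"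
    using assms by (auto simp: orthoconvex_curve_def)
  obtain I U where J: "I \<noteq> {}" "open I" "connected I" "bounded I" "connected U" "\<not> bounded U"
    "I \<inter> U = {}" "I \<union> U = - C" "frontier I = C" "C \<subseteq> closure U" "compact C" "connected C"
    using jordan_plane[OF scc] by blast
  have "inside C \<subseteq> I" using inside_subset[OF J(5,6,8)] .
  moreover have "I \<subseteq> inside C" using interior_inside_frontier[OF J(4)] J(2,9) by (simp add: interior_open)
  ultimately have I: "inside C = I" by blast
  show "frontier (inside C) = C" using I J by simp
  have clI: "closure I = I \<union> C" using J(9) closure_Un_frontier[of I] by blast
  have neC: "C \<noteq> {}" using J(1,4,9) frontier_eq_empty[of I] not_bounded_UNIV by blast
  interpret R: axis_region I
  proof
    show "\<exists>e>0. \<forall>x y. (x, y) \<in> frontier I \<longrightarrow> \<bar>x - a\<bar> < e \<longrightarrow> \<bar>y - c\<bar> < e \<longrightarrow> x = a \<or> y = c" for a c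
      unfolding J(9) by (rule rectilinear_local[OF rect])
  qed fact
  define K where "K = orthogonal_convex_hull S"
  have frK: "frontier K = C" by (simp add: K_def S)
  have "K \<noteq> UNIV" using neC frK by auto
  then have neU: "orthogonal_convex_hull S \<noteq> UNIV" unfolding K_def .
  have hsec: "closed (K \<inter> {p. snd p = c})" "convex (K \<inter> {p. snd p = c})" "bounded (K \<inter> {p. snd p = c})"
    and vsec: "closed (K \<inter> {p. fst p = c})" "convex (K \<inter> {p. fst p = c})" for c
    using hull_section[OF neU disjI1[OF refl], of c] hull_section[OF neU disjI2[OF refl], of c]
    unfolding K_def by simp_all
  have hK: "(x, c) \<in> K" if "(x1, c) \<in> K" "(x2, c) \<in> K" "x1 \<le> x" "x \<le> x2" for x1 x2 x c
  proof -
    have "closed_segment (x1, c) (x2, c) \<subseteq> K \<inter> {p. snd p = c}"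
      using hsec(2)[of c] that by (intro closed_segment_subset) auto
    moreover have "closed_segment (x1, c) (x2, c) = closed_segment x1 x2 \<times> {c}"
      by (auto simp: in_segment algebra_simps)
    ultimately show ?thesis using that by (auto simp: closed_segment_eq_real_ivl)
  qed
  have vK: "(a, y) \<in> K" if "(a, y1) \<in> K" "(a, y2) \<in> K" "y1 \<le> y" "y \<le> y2" for y1 y2 y a
  proof -
    have "closed_segment (a, y1) (a, y2) \<subseteq> K \<inter> {p. fst p = a}"
      using vsec(2)[of a] that by (intro closed_segment_subset) auto
    moreover have "closed_segment (a, y1) (a, y2) = {a} \<times> closed_segment y1 y2"
      by (auto simp: in_segment algebra_simps)
    ultimately show ?thesis using that by (auto simp: closed_segment_eq_real_ivl)
  qed
  have "bounded (closure I)" using J(4) by (rule bounded_closure)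
  then obtain M where M: "\<And>p. p \<in> closure I \<Longrightarrow> norm p \<le> M" by (meson bounded_iff)
  have M': "\<bar>x\<bar> \<le> M" "\<bar>y\<bar> \<le> M" if "(x, y) \<in> closure I" for x y
    using M[OF that] norm_fst_le[of x y] norm_snd_le[of y x] by auto
  \<comment> \<open>Otherwise the connected set \<open>U\<close>, which avoids
    \<open>frontier K\<close>, lies in \<open>K\<close>. But \<open>U\<close> contains the whole row
    at height \<open>M + 1\<close>, whereas sections of \<open>K\<close> are bounded.\<close>
  have UK: "U \<inter> K = {}"
  proof (rule ccontr)
    assume "U \<inter> K \<noteq> {}"
    moreover have "U \<inter> frontier K = {}" using J(8) frK by blast
    ultimately have "U \<subseteq> K" using connected_Int_frontier[OF J(5)] by blast
    moreover have "(x, M + 1) \<in> U" for x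
    proof -
      have "(x, M + 1) \<notin> closure I" using M'(2)[of x "M + 1"] by auto
      then show ?thesis using J(8) clI by blast
    qed
    ultimately have "range (\<lambda>x::real. (x, M + 1)) \<subseteq> K \<inter> {p. snd p = M + 1}" by auto
    then have "bounded (range (\<lambda>x::real. (x, M + 1)))" by (rule bounded_subset[OF hsec(3)])
    then have "bounded (fst ` range (\<lambda>x::real. (x, M + 1)))" by (rule bounded_linear_image[OF _ bounded_linear_fst])
    then show False by (simp add: image_image)
  qed
  then have K_sub: "K \<subseteq> closure I" using J(8) clI by blast
  have IK: "I \<subseteq> K"
  proof (rule ccontr)
    assume "\<not> I \<subseteq> K"
    moreover have "I \<inter> frontier K = {}" using J(8) frK by blast
    ultimately have disj: "I \<inter> K = {}" using connected_Int_frontier[OF J(3)] by blast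
    then have KC: "K \<subseteq> C" using K_sub clI by blast
    obtain x y0 where p0: "(x, y0) \<in> I" using J(1) by auto
    obtain d where d: "d > 0" "\<And>x' y'. \<bar>x' - x\<bar> < d \<Longrightarrow> \<bar>y' - y0\<bar> < d \<Longrightarrow> (x', y') \<in> I"
      using open_contains_box[OF J(2) p0] by blast
    \<comment> \<open>There are only finitely many levels, so some row through \<open>I\<close> is
      not a level.\<close>
    have "infinite ({y0<..<y0+d} - h_levels C)"
      using d(1) finite_h_levels[OF rect] by (intro Diff_infinite_finite) (auto simp: infinite_Ioo)
    then obtain y where y: "y0 < y" "y < y0 + d" "y \<notin> h_levels C"
      by (metis (no_types) DiffE ex_in_conv finite.emptyI greaterThanLessThan_iff)
    have p: "(x, y) \<in> I" using d y by auto
    have cross: "\<exists>x'. (x', y) \<in> C \<and> x' \<in> {u..v}" if "x \<in> {u..v}" "(u, y) \<notin> I \<or> (v, y) \<notin> I" for u v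
    proof -
      have "u \<le> v" "(x, y) \<in> {u..v} \<times> {y}" using that by auto
      moreover from \<open>u \<le> v\<close> have "(u, y) \<in> {u..v} \<times> {y}" "(v, y) \<in> {u..v} \<times> {y}" by auto
      ultimately have "({u..v} \<times> {y}) \<inter> I \<noteq> {}" "({u..v} \<times> {y}) - I \<noteq> {}"
        using p that(2) by blast+
      moreover have "connected ({u..v} \<times> {y})" by (intro connected_Times) auto
      ultimately have "({u..v} \<times> {y}) \<inter> frontier I \<noteq> {}" by (intro connected_Int_frontier)
      then show ?thesis using J(9) by auto
    qed
    have "\<bar>x\<bar> \<le> M" using M' p closure_subset by blast
    then have xM: "- M - 1 \<le> x" "x \<le> M + 1" by linarith+
    have "(- M - 1, y) \<notin> I" "(M + 1, y) \<notin> I"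
      using M'(1)[of "- M - 1" y] M'(1)[of "M + 1" y] closure_subset by fastforce+
    with xM obtain x1 x2 where x12: "(x1, y) \<in> C" "x1 \<le> x" "(x2, y) \<in> C" "x \<le> x2"
      using cross[of "- M - 1" x] cross[of x "M + 1"] by (meson atLeastAtMost_iff order_refl)
    have inK: "(x', y) \<in> K" if x': "(x', y) \<in> C" for x'
    proof -
      obtain e where e: "e > 0" "\<And>u v. (u, v) \<in> C \<Longrightarrow> \<bar>u - x'\<bar> < e \<Longrightarrow> \<bar>v - y\<bar> < e \<Longrightarrow> u = x' \<or> v = y"
        using rectilinear_local[OF rect] by metis
      have "finite {u. (u, y) \<in> C}" using y(3) by (simp add: h_levels_def)
      then obtain e' where e': "e' > 0" "\<And>u. (u, y) \<in> C \<Longrightarrow> u \<noteq> x' \<Longrightarrow> e' \<le> dist x' u"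
        using finite_set_avoid[of "{u. (u, y) \<in> C}" x'] by auto
      have "(x', y) \<in> closure K" using frK x' by (auto simp: frontier_def)
      \<comment> \<open>Points of \<open>K\<close> near \<open>(x', y)\<close> lie on
        \<open>C\<close>, hence on the cross through it, and \<open>C\<close> has no other nearby
        point in row \<open>y\<close>. So they all lie in column \<open>x'\<close>, whose section is
        closed.\<close>
      have "(x', y) \<in> closure (K \<inter> {p. fst p = x'})"
        unfolding in_closure_iff_box
      proof (intro allI impI)
        fix \<delta> :: real assume "\<delta> > 0"
        then have "min \<delta> (min e e') > 0" using e e' by auto
        then obtain u v where uv: "(u, v) \<in> K" "\<bar>u - x'\<bar> < min \<delta> (min e e')" "\<bar>v - y\<bar> < min \<delta> (min e e')"
          using \<open>(x', y) \<in> closure K\<close> unfolding in_closure_iff_box by meson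
        have "u = x' \<or> v = y" using uv KC by (intro e(2)) auto
        moreover have "u = x'" if "v = y"
          using e'(2)[of u] uv KC that by (auto simp: dist_real_def abs_minus_commute)
        ultimately have "u = x'" by blast
        with uv show "\<exists>u v. (u, v) \<in> K \<inter> {p. fst p = x'} \<and> \<bar>u - x'\<bar> < \<delta> \<and> \<bar>v - y\<bar> < \<delta>"
          by (intro exI[of _ u] exI[of _ v]) auto
      qed
      then show ?thesis using vsec(1)[of x'] by (simp add: closure_closed)
    qed
    have "(x, y) \<in> K" using hK inK x12 by blast
    with p disj show False by blast
  qed
  have clK: "closure I \<subseteq> K"
  proof clarify
    fix a c assume "(a, c) \<in> closure I"
    then obtain e s t where q: "e > 0" "s \<in> {1, -1 :: real}" "t \<in> {1, -1 :: real}"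
      "\<And>u v. 0 < u \<Longrightarrow> u < e \<Longrightarrow> 0 < v \<Longrightarrow> v < e \<Longrightarrow> (a + s * u, c + t * v) \<in> I"
      using R.quadrant by blast
    \<comment> \<open>The quadrant is in \<open>K\<close> already. Closed column sections add its
      horizontal edge, and the closed row section then adds the vertex
      \<open>(a, c)\<close>.\<close>
    have row: "(a + s * u, c) \<in> K" if u: "0 < u" "u < e" for u
    proof -
      have "(a + s * u, c) \<in> closure (K \<inter> {p. fst p = a + s * u})"
        unfolding in_closure_iff_box
      proof (intro allI impI)
        fix \<delta> :: real assume \<delta>: "\<delta> > 0"
        then have "(a + s * u, c + t * (min \<delta> e / 2)) \<in> I"
          using q(1) u by (intro q(4)) auto
        then show "\<exists>x' y'. (x', y') \<in> K \<inter> {p. fst p = a + s * u} \<and> \<bar>x' - (a + s * u)\<bar> < \<delta> \<and> \<bar>y' - c\<bar> < \<delta>"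
          using \<delta> q(1,3) IK
          by (intro exI[of _ "a + s * u"] exI[of _ "c + t * (min \<delta> e / 2)"]) auto
      qed
      then show ?thesis using vsec(1)[of "a + s * u"] by (simp add: closure_closed)
    qed
    have "(a, c) \<in> closure (K \<inter> {p. snd p = c})"
      unfolding in_closure_iff_box
    proof (intro allI impI)
      fix \<delta> :: real assume \<delta>: "\<delta> > 0"
      then have "(a + s * (min \<delta> e / 2), c) \<in> K"
        using q(1) by (intro row) auto
      then show "\<exists>x' y'. (x', y') \<in> K \<inter> {p. snd p = c} \<and> \<bar>x' - a\<bar> < \<delta> \<and> \<bar>y' - c\<bar> < \<delta>"
        using \<delta> q(1,2) by (intro exI[of _ "a + s * (min \<delta> e / 2)"] exI[of _ c]) auto
    qed
    then show "(a, c) \<in> K" using hsec(1)[of c] by (simp add: closure_closed)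
  qed
  have K: "K = closure I" using K_sub clK by blast
  \<comment> \<open>Every point of \<open>C\<close> is a limit of the outer region \<open>U\<close>,
    so it has no neighbourhood inside \<open>closure I\<close>.\<close>
  have "interior (closure I) \<subseteq> I"
  proof
    fix p assume p: "p \<in> interior (closure I)"
    show "p \<in> I"
    proof (rule ccontr)
      assume "p \<notin> I"
      then have "p \<in> closure U" using p interior_subset clI J(10) by blast
      then have "interior (closure I) \<inter> U \<noteq> {}"
        using p open_Int_closure_eq_empty[of "interior (closure I)" U] by auto
      then show False using interior_subset clI J(7,8) by blast
    qed
  qed
  then have intcl: "interior (closure I) = I"
    using J(2) interior_maximal[of I "closure I"] closure_subset by blast
  \<comment> \<open>A single point encloses nothing. A connected set with more than one point has no
    isolated points, as \<open>rectilinear_on_level\<close> requires.\<close>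
  have "C \<noteq> {p}" for p using I J(1) inside_singleton by metis
  then have lim: "p islimpt C" if "p \<in> C" for p using connected_imp_perfect[OF J(12)] that by blast
  have "ortho_region I"
  proof
    show "(x, c) \<in> closure I" if "(x1, c) \<in> closure I" "(x2, c) \<in> closure I" "x1 \<le> x" "x \<le> x2" for x1 c x2 x
      using hK that K by blast
    show "(a, y) \<in> closure I" if "(a, y1) \<in> closure I" "(a, y2) \<in> closure I" "y1 \<le> y" "y \<le> y2" for a y1 y2 y
      using vK that K by blast
    show "x \<in> v_levels (frontier I) \<or> y \<in> h_levels (frontier I)" if "(x, y) \<in> frontier I" for x y
      using rectilinear_on_level[OF rect lim] that J(9) by blast
  qed (use J intcl rect finite_h_levels finite_v_levels in auto)
  then show "ortho_region (inside C)" using I by simp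
qed

section \<open>Covering the grid\<close>

lemma orthoconvex_curve_l_shaped:
  assumes "orthoconvex_curve C" "finite {p. inner_corner C p}" "card {p. inner_corner C p} \<le> 1"
  shows "l_shaped C"
proof -
  interpret ortho_region "inside C" by (rule orthoconvex_curve_region(1)[OF assms(1)])
  have fr: "frontier (inside C) = C" by (rule orthoconvex_curve_region(2)[OF assms(1)])
  \<comment> \<open>This inclusion alone transfers the bound on inner corners to reflex
    corners.\<close>
  have "{p. reflex_corner (inside C) (fst p) (snd p)} \<subseteq> {p. inner_corner C p}"
    using reflex_corner_is_corner reflex_corner_interior_angle
    by (auto simp: inner_corner_def fr)
  then have R: "finite {p. reflex_corner (inside C) (fst p) (snd p)}"
    "card {p. reflex_corner (inside C) (fst p) (snd p)} \<le> 1"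
    using assms(2,3) card_mono[OF assms(2)] by (auto intro: finite_subset dest: order_trans)
  have box: "card (h_levels C) + card (v_levels C) \<le> 4"
    if "\<forall>x\<in>v_levels C. l \<le> x \<and> x \<le> r" "\<forall>y\<in>h_levels C. b \<le> y \<and> y \<le> t"
      "{(l, b), (l, t), (r, b), (r, t)} \<subseteq> C" for l r b t
    using card_levels_of_box[of l r b t] that unfolding fr by simp
  have ext: "(x \<in> v_levels C \<or> y \<in> h_levels C) \<and>
      (\<exists>l\<in>v_levels C. l \<le> x) \<and> (\<exists>r\<in>v_levels C. x \<le> r) \<and>
      (\<exists>b\<in>h_levels C. b \<le> y) \<and> (\<exists>t\<in>h_levels C. y \<le> t)" if "(x, y) \<in> C" for x y
    using on_level[of x y] v_level_below[of x y] v_level_above[of x y] h_level_below[of x y] h_level_above[of x y] that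
    unfolding fr by simp
  show ?thesis
    unfolding l_shaped_def
    using finite_h finite_v card_h_levels_le_3[OF R] card_v_levels_le_3[OF R] ext box
    unfolding fr by simp
qed

text \<open>The map \<open>g\<close> parametrizes a row or a column that is a level of no
  curve.\<close>

lemma covered_section:
  fixes n :: nat and g :: "real \<Rightarrow> 'a"
  assumes "finite \<C>" "\<And>C. C \<in> \<C> \<Longrightarrow> finite {x. g x \<in> C} \<and> card {x. g x \<in> C} \<le> 2"
    and "\<And>i. i \<in> {1..n} \<Longrightarrow> \<exists>C\<in>\<C>. g (real i) \<in> C"
  shows "n \<le> 2 * card \<C>"
proof -
  have "n = card (real ` {1..n})" by (simp add: card_image)
  also have "\<dots> \<le> card (\<Union>C\<in>\<C>. {x. g x \<in> C})"
    using assms by (intro card_mono) auto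
  also have "\<dots> \<le> (\<Sum>C\<in>\<C>. card {x. g x \<in> C})" using assms(1) by (rule card_UN_le)
  also have "\<dots> \<le> (\<Sum>C\<in>\<C>. 2)" using assms(2) by (intro sum_mono) auto
  finally show ?thesis by simp
qed

theorem theorem21:
  fixes n m :: nat and \<C> :: "(real \<times> real) set set"
  assumes "n \<ge> 1" and "m \<ge> 1"
    and "finite \<C>" and "card \<C> = m"
    and "\<And>C. C \<in> \<C> \<Longrightarrow> orthoconvex_curve C"
    and "\<And>C. C \<in> \<C> \<Longrightarrow> finite {p. inner_corner C p} \<and> card {p. inner_corner C p} \<le> 1"
    and "covers \<C> (grid n)"
  shows "real m \<ge> 2 * real n / 5"
proof (cases "n \<le> 2 * m")
  \<comment> \<open>Here 2n/5 \<le> 4m/5 \<le> m.\<close>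
  case True
  then have "real n \<le> real (2 * m)" by (rule of_nat_mono)
  then show ?thesis by simp
next
  case False
  define X where "X = real ` {1..n}"
  have cov: "\<exists>C\<in>\<C>. (x, y) \<in> C" if "x \<in> X" "y \<in> X" for x y
    using assms(7) that by (auto simp: covers_def grid_def X_def)
  have reg: "ortho_region (inside C)" "frontier (inside C) = C" if "C \<in> \<C>" for C
    using orthoconvex_curve_region assms(5)[OF that] by blast+
  \<comment> \<open>A row that is no level gets at most two points from each curve, too few for its
    n > 2m grid points.\<close>
  have h: "y \<in> (\<Union>C\<in>\<C>. h_levels C)" if "y \<in> X" for y
  proof (rule ccontr)
    assume "y \<notin> (\<Union>C\<in>\<C>. h_levels C)"
    then have "finite {x. (x, y) \<in> C} \<and> card {x. (x, y) \<in> C} \<le> 2" if "C \<in> \<C>" for C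
      using ortho_region.card_h_section[OF reg(1)[OF that], of y] that reg(2)[OF that] by auto
    then have "n \<le> 2 * card \<C>"
      using cov that by (intro covered_section[OF assms(3), of "\<lambda>x. (x, y)"]) (auto simp: X_def)
    with False assms(4) show False by simp
  qed
  have v: "x \<in> (\<Union>C\<in>\<C>. v_levels C)" if "x \<in> X" for x
  proof (rule ccontr)
    assume "x \<notin> (\<Union>C\<in>\<C>. v_levels C)"
    then have "finite {y. (x, y) \<in> C} \<and> card {y. (x, y) \<in> C} \<le> 2" if "C \<in> \<C>" for C
      using ortho_region.card_v_section[OF reg(1)[OF that], of x] that reg(2)[OF that] by auto
    then have "n \<le> 2 * card \<C>"
      using cov that by (intro covered_section[OF assms(3), of "\<lambda>y. (x, y)"]) (auto simp: X_def)
    with False assms(4) show False by simp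
  qed
  have "card X + card X \<le> 5 * card \<C>"
  proof (rule card_grid_lines_le)
    show "l_shaped C" if "C \<in> \<C>" for C
      using orthoconvex_curve_l_shaped assms(5,6) that by blast
  qed (use assms(3) cov h v in \<open>auto simp: X_def\<close>)
  moreover have "card X = n" by (simp add: X_def card_image)
  ultimately have "2 * n \<le> 5 * m" using assms(4) by simp
  then have "real (2 * n) \<le> real (5 * m)" by (rule of_nat_mono)
  then show ?thesis by simp
qed

end
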